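(* For lazy exploration with laziness factor $\delta\in(0,1)$ the following hold. (a) For fixed $n\ge2$, almost surely $\mu_n^{(k,\mathrm{lazy})}$ converges weakly to $\mu_n^{(\infty,\mathrm c)}$ as $k\to\infty$, where $$\mu_n^{(\infty,\mathrm c)}=\frac1n\sum_{i\in[n]}\delta_{\Delta_{i,n}^{(\mathrm{st},\mathrm c)}},\qquad \Delta_{i,n}^{(\mathrm{st},\mathrm c)}=\sum_{j\in[n]}\pi_n^{(\mathrm c)}(j)\,d_j^{(G_n)}-d_i^{(G_n)}.$$ (b) Suppose that $((d_i^{(G_n)})^2)_{i\in[n],\,n\ge2}$ is uniformly integrable, and that $\mathbb P_n\{G_n\text{ is connected}\}\to1$ as $n\to\infty$. If $G_n$ converges locally in probability as $n\to\infty$ to $(G_\infty,\phi)$, with a deterministic law $\bar\Lambda$, then $\mu_n^{(\infty,\mathrm c)}$ converges weakly to $\mu$ in probability as $n\to\infty$, where $\mu$ is the law of $$\Delta_\phi=\frac{m^{(2)}}{m^{(1)}}-d_\phi,\qquad m^{(1)}=\mathbb E_{\bar\Lambda}[d_\phi],\quad m^{(2)}=\mathbb E_{\bar\Lambda}[d_\phi^2],$$ with $d_\phi$ the degree of the root $\phi$ in $G_\infty$.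
   Context: Graphs are undirected, simple or multi-graphs; $A^{(G)}_{i,j}$ is the number of edges connecting $i,j$ and $d_i^{(G)}$ the degree of $i$ in $G$. $G_n$ ($n\ge2$) is a random graph with vertex set $[n]=\{1,\dots,n\}$ on a probability space $(\Omega_n,\mathcal F_n,\mathbb P_n)$, without self-loops and isolated vertices (not necessarily connected). $C_i$ is the connected component of $G_n$ containing $i$, and $$\pi_n^{(\mathrm c)}(i)=\frac{d_i^{(G_n)}}{\sum_{j\in V(C_i)}d_j^{(G_n)}},\qquad i\in[n].$$ Lazy exploration with laziness factor $\delta\in(0,1)$: at each step the random walk on $G_n$ stays put with probability $\delta$ and with probability $1-\delta$ performs a step of the backtracking random walk, whose transition matrix is $P_n(i,j)=A^{(G_n)}_{i,j}/d_i^{(G_n)}$. Thus its $k$-step transition matrix is $P_n^{(k,\mathrm{lazy})}=(\delta I_n+(1-\delta)P_n)^k$, with $I_n$ the $n\times n$ identity matrix. Set $\Delta_{i,n}^{(k,\mathrm{lazy})}=\sum_{j\in[n]}P_n^{(k,\mathrm{lazy})}(i,j)\,d_j^{(G_n)}-d_i^{(G_n)}$ and $\mu_n^{(k,\mathrm{lazy})}=\frac1n\sum_{i\in[n]}\delta_{\Delta_{i,n}^{(k,\mathrm{lazy})}}$ (a random measure; $\delta_x$ with a subscript is the Dirac measure at $x$). $(G_\infty,\phi)$ is an almost surely locally finite non-trivial (more than one vertex) rooted random tree with law $\bar\Lambda$. "Deterministic law" means $\bar\Lambda$ is a fixed (non-random) probability measure; $\mathbb E_{\bar\Lambda}$ is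 its expectation. Local convergence in probability. For a rooted graph $(H,o)$, $B_r^{(H)}(o)$ is the rooted subgraph with root $o$ whose vertices are those at graph distance $\le r$ from $o$ and whose edges are all edges of $H$ between such vertices. $\mathscr G$ is the set of connected locally finite rooted graphs, up to rooted isomorphism, with metric $\mathrm d_{\mathscr G}((H_1,o_1),(H_2,o_2))=\big(1+\sup\{r\ge0: B_r^{(H_1)}(o_1)\simeq B_r^{(H_2)}(o_2)\}\big)^{-1}$. $\mathscr C(G_n,i)$ is the connected component of $i$ in $G_n$, rooted at $i$. $G_n$ converges locally in probability to $(G_\infty,\phi)$ if $\frac1n\sum_{i\in[n]}h(\mathscr C(G_n,i))\to\mathbb E_{\bar\Lambda}[h((G_\infty,\phi))]$ in probability for every bounded continuous $h:\mathscr G\to\mathbb R$. A family of non-negative random variables (possibly on different probability spaces) is uniformly integrable if $\sup \mathbb E[X\mathbf 1_{\{X>M\}}]\to0$ as $M\to\infty$, the supremum being over the family. Weak convergence in probability of random measures $\nu_n$ to $\nu$ means $\int f\,d\nu_n\to\int f\,d\nu$ in probability for every bounded continuous $f:\mathbb R\to\mathbb R$.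
   Formalization: In Δ^{(st,c)}_{i,n} the sum runs over j in V(C_i), the component of i, instead of all j in [n]; as printed, (a) fails for disconnected graphs (two disjoint edges: Δ^{(k,lazy)}=0 for all k, but the printed limit is 1). For connected G_n the formulas agree. *)

theory Defs
  imports "HOL-Probability.Probability" "Jordan_Normal_Form.Matrix"
begin

section \<open>Multigraphs\<close>

text \<open>
  An undirected multigraph is given by its vertex set and the numbers \<open>adj H x y\<close> of edges
  connecting \<open>x\<close> and \<open>y\<close>; a simple graph is the case of values in \<open>{0, 1}\<close>.  Connected locally
  finite graphs are countable, so vertices in \<^typ>\<open>nat\<close> represent every isomorphism class.
\<close>

datatype mgraph = MGraph (verts: "nat set") (adj: "nat \<Rightarrow> nat \<Rightarrow> nat")

definition multigraph :: "mgraph \<Rightarrow> bool" where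
  "multigraph H \<longleftrightarrow>
     (\<forall>x y. adj H x y = adj H y x) \<and>
     (\<forall>x y. adj H x y > 0 \<longrightarrow> x \<in> verts H \<and> y \<in> verts H)"

definition loopless :: "mgraph \<Rightarrow> bool" where
  "loopless H \<longleftrightarrow> (\<forall>x. adj H x x = 0)"

definition edge_rel :: "mgraph \<Rightarrow> (nat \<times> nat) set" where
  "edge_rel H = {(x, y). adj H x y > 0}"

definition locally_finite :: "mgraph \<Rightarrow> bool" where
  "locally_finite H \<longleftrightarrow> (\<forall>x\<in>verts H. finite {y. adj H x y > 0})"

text \<open>Degrees are only used below for loopless graphs, so no convention for loops is involved.\<close>

definition vertex_degree :: "mgraph \<Rightarrow> nat \<Rightarrow> nat" where
  "vertex_degree H x = (\<Sum>y | adj H x y > 0. adj H x y)"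

definition no_isolated_vertices :: "mgraph \<Rightarrow> bool" where
  "no_isolated_vertices H \<longleftrightarrow> (\<forall>x\<in>verts H. vertex_degree H x > 0)"

definition graph_connected :: "mgraph \<Rightarrow> bool" where
  "graph_connected H \<longleftrightarrow> (\<forall>x\<in>verts H. \<forall>y\<in>verts H. (x, y) \<in> (edge_rel H)\<^sup>*)"

text \<open>Graph distance; it is \<open>\<infinity>\<close> for vertices in different components.\<close>

definition graph_dist :: "mgraph \<Rightarrow> nat \<Rightarrow> nat \<Rightarrow> enat" where
  "graph_dist H x y = (INF k\<in>{k. (x, y) \<in> edge_rel H ^^ k}. enat k)"

definition induced :: "mgraph \<Rightarrow> nat set \<Rightarrow> mgraph" where
  "induced H S = MGraph (verts H \<inter> S) (\<lambda>x y. if x \<in> S \<and> y \<in> S then adj H x y else 0)"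

definition graph_ball :: "mgraph \<Rightarrow> nat \<Rightarrow> nat \<Rightarrow> mgraph" where
  "graph_ball H x r = induced H {y. graph_dist H x y \<le> enat r}"

definition component :: "mgraph \<Rightarrow> nat \<Rightarrow> mgraph" where
  "component H x = induced H {y. (x, y) \<in> (edge_rel H)\<^sup>*}"

text \<open>Loops and multiple edges count as cycles, whence the first two conditions on a tree.\<close>

definition cycle :: "mgraph \<Rightarrow> nat list \<Rightarrow> bool" where
  "cycle H xs \<longleftrightarrow> length xs \<ge> 3 \<and> distinct xs \<and> set xs \<subseteq> verts H \<and>
     (\<forall>i<length xs. adj H (xs ! i) (xs ! (Suc i mod length xs)) > 0)"

definition tree :: "mgraph \<Rightarrow> bool" where
  "tree H \<longleftrightarrow> loopless H \<and> (\<forall>x y. adj H x y \<le> 1) \<and> graph_connected H \<and> (\<nexists>xs. cycle H xs)"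


section \<open>The space of rooted graphs\<close>

definition rooted_graph :: "mgraph \<times> nat \<Rightarrow> bool" where
  "rooted_graph = (\<lambda>(H, x). multigraph H \<and> locally_finite H \<and> graph_connected H \<and> x \<in> verts H)"

definition rooted_map :: "(nat \<Rightarrow> nat) \<Rightarrow> mgraph \<times> nat \<Rightarrow> mgraph \<times> nat \<Rightarrow> bool" where
  "rooted_map f = (\<lambda>(H, x) (H', x').
     bij_betw f (verts H) (verts H') \<and> f x = x' \<and>
     (\<forall>y\<in>verts H. \<forall>z\<in>verts H. adj H' (f y) (f z) = adj H y z))"

definition rooted_iso :: "mgraph \<times> nat \<Rightarrow> mgraph \<times> nat \<Rightarrow> bool" where
  "rooted_iso p q \<longleftrightarrow> (\<exists>f. rooted_map f p q)"

definition rooted_ball :: "nat \<Rightarrow> mgraph \<times> nat \<Rightarrow> mgraph \<times> nat" where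
  "rooted_ball r = (\<lambda>(H, x). (graph_ball H x r, x))"

definition rooted_equiv :: "mgraph \<times> nat \<Rightarrow> mgraph \<times> nat \<Rightarrow> bool" where
  "rooted_equiv p q \<longleftrightarrow> rooted_graph p \<and> rooted_graph q \<and> rooted_iso p q"

lemma rooted_map_id: "rooted_map id p p"
  by (auto simp: rooted_map_def split: prod.splits)

lemma rooted_iso_refl: "rooted_iso p p"
  unfolding rooted_iso_def using rooted_map_id by blast

lemma rooted_map_comp:
  assumes "rooted_map f p q" "rooted_map g q r"
  shows "rooted_map (g \<circ> f) p r"
proof -
  obtain H x H' x' H'' x'' where pqr: "p = (H, x)" "q = (H', x')" "r = (H'', x'')"
    by (cases p, cases q, cases r) auto
  have "f y \<in> verts H'" if "y \<in> verts H" for y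
    using assms that by (auto simp: rooted_map_def pqr bij_betw_def)
  then show ?thesis
    using assms by (auto simp: rooted_map_def pqr intro: bij_betw_trans)
qed

lemma rooted_iso_trans: "rooted_iso p q \<Longrightarrow> rooted_iso q r \<Longrightarrow> rooted_iso p r"
  unfolding rooted_iso_def using rooted_map_comp by blast

lemma rooted_map_inv:
  assumes "rooted_map f (H, x) (H', x')" "x \<in> verts H"
  shows "rooted_map (inv_into (verts H) f) (H', x') (H, x)"
proof -
  let ?g = "inv_into (verts H) f"
  have b: "bij_betw f (verts H) (verts H')" and fx: "f x = x'"
    and a: "\<And>y z. y \<in> verts H \<Longrightarrow> z \<in> verts H \<Longrightarrow> adj H' (f y) (f z) = adj H y z"
    using assms(1) by (auto simp: rooted_map_def)
  have g: "?g y \<in> verts H" "f (?g y) = y" if "y \<in> verts H'" for y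
    using b that by (auto simp: bij_betw_def inv_into_into f_inv_into_f)
  have "adj H (?g y) (?g z) = adj H' y z" if "y \<in> verts H'" "z \<in> verts H'" for y z
    using a[OF g(1)[OF that(1)] g(1)[OF that(2)]] g(2) that by simp
  moreover have "?g x' = x"
    using fx assms(2) b by (metis bij_betw_def inv_into_f_f)
  ultimately show ?thesis
    using bij_betw_inv_into[OF b] by (auto simp: rooted_map_def)
qed

lemma rooted_iso_sym:
  assumes "rooted_iso p q" "snd p \<in> verts (fst p)"
  shows "rooted_iso q p"
  using assms rooted_map_inv unfolding rooted_iso_def by (metis prod.collapse)

lemma root_in_verts: "rooted_graph p \<Longrightarrow> snd p \<in> verts (fst p)"
  by (auto simp: rooted_graph_def split: prod.splits)

quotient_type rgraph = "mgraph \<times> nat" / partial: rooted_equiv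
proof (rule part_equivpI)
  have "rooted_graph (MGraph {0} (\<lambda>_ _. 0), 0)"
    by (auto simp: rooted_graph_def multigraph_def locally_finite_def graph_connected_def)
  then show "\<exists>p. rooted_equiv p p"
    using rooted_iso_refl by (auto simp: rooted_equiv_def)
  show "symp rooted_equiv"
    unfolding symp_def rooted_equiv_def using root_in_verts rooted_iso_sym by blast
  show "transp rooted_equiv"
    unfolding transp_def rooted_equiv_def using rooted_iso_trans by blast
qed

definition agree_radii :: "mgraph \<times> nat \<Rightarrow> mgraph \<times> nat \<Rightarrow> nat set" where
  "agree_radii p q = {r. rooted_iso (rooted_ball r p) (rooted_ball r q)}"

lemma mem_ball_iff: "graph_dist H x y \<le> enat r \<longleftrightarrow> (\<exists>k\<le>r. (x, y) \<in> edge_rel H ^^ k)"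
proof
  assume le: "graph_dist H x y \<le> enat r"
  let ?K = "{k. (x, y) \<in> edge_rel H ^^ k}"
  have "?K \<noteq> {}"
  proof
    assume "?K = {}"
    then have "graph_dist H x y = \<infinity>" by (simp only: graph_dist_def) (simp add: top_enat_def)
    then show False using le by simp
  qed
  then obtain k where "k \<in> ?K" by blast
  then have "graph_dist H x y \<in> enat ` ?K"
    unfolding graph_dist_def by (intro wellorder_InfI[of "enat k"] imageI)
  then show "\<exists>k\<le>r. (x, y) \<in> edge_rel H ^^ k" using le by auto
next
  assume "\<exists>k\<le>r. (x, y) \<in> edge_rel H ^^ k"
  then obtain k where "k \<le> r" "(x, y) \<in> edge_rel H ^^ k" by blast
  then have "graph_dist H x y \<le> enat k" unfolding graph_dist_def by (auto intro: INF_lower)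
  then show "graph_dist H x y \<le> enat r" using \<open>k \<le> r\<close> by (meson enat_ord_simps(1) order_trans)
qed

lemma relpow_in_verts:
  assumes "multigraph H" "x \<in> verts H" "(x, y) \<in> edge_rel H ^^ k"
  shows "y \<in> verts H"
  using assms by (cases k) (auto simp: multigraph_def edge_rel_def)

lemma verts_ball:
  assumes "multigraph H" "x \<in> verts H"
  shows "verts (graph_ball H x r) = {y. \<exists>k\<le>r. (x, y) \<in> edge_rel H ^^ k}"
  using relpow_in_verts[OF assms] by (auto simp: graph_ball_def induced_def mem_ball_iff)

lemma adj_ball:
  assumes "y \<in> verts (graph_ball H x r)" "z \<in> verts (graph_ball H x r)"
  shows "adj (graph_ball H x r) y z = adj H y z"
  using assms by (auto simp: graph_ball_def induced_def)

lemma graph_ball_mono: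
  "r \<le> s \<Longrightarrow> verts (graph_ball H x r) \<subseteq> verts (graph_ball H x s)"
  by (auto simp: graph_ball_def induced_def mem_ball_iff) (meson order_trans)

lemma root_in_ball: "x \<in> verts H \<Longrightarrow> x \<in> verts (graph_ball H x r)"
  by (auto simp: graph_ball_def induced_def mem_ball_iff intro!: exI[of _ 0])

lemma finite_ball:
  assumes "rooted_graph (H, x)"
  shows "finite (verts (graph_ball H x r))"
proof -
  have H: "multigraph H" "locally_finite H" "x \<in> verts H"
    using assms by (auto simp: rooted_graph_def)
  have "finite {y. (x, y) \<in> edge_rel H ^^ k}" for k
  proof (induction k)
    case (Suc k)
    have "{y. (x, y) \<in> edge_rel H ^^ Suc k} \<subseteq>
        (\<Union>z\<in>{z. (x, z) \<in> edge_rel H ^^ k}. {y. adj H z y > 0})"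
      by (auto simp: edge_rel_def)
    moreover have "finite {y. adj H z y > 0}" if "(x, z) \<in> edge_rel H ^^ k" for z
      using H(2) relpow_in_verts[OF H(1,3) that] by (auto simp: locally_finite_def)
    then have "finite (\<Union>z\<in>{z. (x, z) \<in> edge_rel H ^^ k}. {y. adj H z y > 0})"
      using Suc by blast
    ultimately show ?case by (rule finite_subset)
  qed auto
  moreover have "verts (graph_ball H x r) = (\<Union>k\<in>{..r}. {y. (x, y) \<in> edge_rel H ^^ k})"
    using verts_ball[OF H(1,3)] by auto
  ultimately show ?thesis by auto
qed

lemma rooted_map_relpow:
  assumes "rooted_map f (rooted_ball r (H, x)) (rooted_ball r (H', x'))"
    and "multigraph H" "x \<in> verts H"
  shows "k \<le> r \<Longrightarrow> (x, y) \<in> edge_rel H ^^ k \<Longrightarrow> (x', f y) \<in> edge_rel H' ^^ k"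
proof (induction k arbitrary: y)
  case 0
  then show ?case using assms(1) by (auto simp: rooted_map_def rooted_ball_def)
next
  case (Suc k)
  then obtain z where z: "(x, z) \<in> edge_rel H ^^ k" "adj H z y > 0"
    by (auto simp: edge_rel_def)
  have "k \<le> r" using Suc.prems by simp
  then have in1: "z \<in> verts (graph_ball H x r)" "y \<in> verts (graph_ball H x r)"
    using Suc.prems z(1) unfolding verts_ball[OF assms(2,3)] by blast+
  have bij: "bij_betw f (verts (graph_ball H x r)) (verts (graph_ball H' x' r))"
    using assms(1) by (auto simp: rooted_map_def rooted_ball_def)
  then have in2: "f z \<in> verts (graph_ball H' x' r)" "f y \<in> verts (graph_ball H' x' r)"
    using in1 by (auto simp: bij_betw_def)
  have "adj (graph_ball H' x' r) (f z) (f y) = adj (graph_ball H x r) z y"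
    using assms(1) in1 by (auto simp: rooted_map_def rooted_ball_def)
  then have "adj H' (f z) (f y) = adj H z y"
    using adj_ball in1 in2 by simp
  moreover have "(x', f z) \<in> edge_rel H' ^^ k" using Suc.IH[of z] Suc.prems z by simp
  ultimately show ?case using z by (auto simp: edge_rel_def)
qed

lemma rooted_map_ball_mono:
  assumes f: "rooted_map f (rooted_ball r (H, x)) (rooted_ball r (H', x'))"
    and H: "rooted_graph (H, x)" and H': "rooted_graph (H', x')" and "s \<le> r"
  shows "rooted_map f (rooted_ball s (H, x)) (rooted_ball s (H', x'))"
proof -
  let ?V = "\<lambda>s. verts (graph_ball H x s)" and ?V' = "\<lambda>s. verts (graph_ball H' x' s)"
  have h: "multigraph H" "x \<in> verts H" and h': "multigraph H'" "x' \<in> verts H'"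
    using H H' by (auto simp: rooted_graph_def)
  have bij: "bij_betw f (?V r) (?V' r)" and fx: "f x = x'"
    and adj: "\<And>y z. y \<in> ?V r \<Longrightarrow> z \<in> ?V r \<Longrightarrow>
      adj (graph_ball H' x' r) (f y) (f z) = adj (graph_ball H x r) y z"
    using f by (auto simp: rooted_map_def rooted_ball_def)
  define g where "g = inv_into (?V r) f"
  have g: "rooted_map g (rooted_ball r (H', x')) (rooted_ball r (H, x))"
    using rooted_map_inv[OF f[unfolded rooted_ball_def prod.case] root_in_ball[OF h(2)]]
    by (simp add: rooted_ball_def g_def)
  have sub: "?V s \<subseteq> ?V r" "?V' s \<subseteq> ?V' r"
    using graph_ball_mono[OF \<open>s \<le> r\<close>] by auto
  have "f ` ?V s \<subseteq> ?V' s"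
    using rooted_map_relpow[OF f h] \<open>s \<le> r\<close>
    by (force simp: verts_ball[OF h] verts_ball[OF h'])
  moreover have "?V' s \<subseteq> f ` ?V s"
  proof
    fix y assume y: "y \<in> ?V' s"
    then have "g y \<in> ?V s"
      using rooted_map_relpow[OF g h'] \<open>s \<le> r\<close>
      by (force simp: verts_ball[OF h] verts_ball[OF h'])
    moreover have "f (g y) = y"
      using y sub bij by (auto simp: g_def bij_betw_def f_inv_into_f)
    ultimately show "y \<in> f ` ?V s" by force
  qed
  ultimately have img: "f ` ?V s = ?V' s" by blast
  moreover have "inj_on f (?V s)"
    using bij sub by (meson bij_betw_def inj_on_subset)
  moreover have "adj (graph_ball H' x' s) (f y) (f z) = adj (graph_ball H x s) y z"
    if yz: "y \<in> ?V s" "z \<in> ?V s" for y z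
  proof -
    have "f y \<in> ?V' s" "f z \<in> ?V' s" using yz img by auto
    then show ?thesis
      using yz adj[of y z] sub adj_ball[of _ H' x' s] adj_ball[of _ H' x' r]
        adj_ball[of _ H x s] adj_ball[of _ H x r] by (simp add: subset_iff)
  qed
  ultimately show ?thesis
    using fx by (auto simp: rooted_map_def rooted_ball_def bij_betw_def)
qed

lemma agree_radii_downward:
  assumes "rooted_graph p" "rooted_graph q" "r \<in> agree_radii p q" "s \<le> r"
  shows "s \<in> agree_radii p q"
proof -
  obtain H x H' x' where pq: "p = (H, x)" "q = (H', x')" by (cases p, cases q) auto
  show ?thesis
    using assms rooted_map_ball_mono unfolding pq agree_radii_def rooted_iso_def by blast
qed

lemma in_verts_ball:
  assumes "rooted_graph (H, x)" "y \<in> verts H"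
  obtains r where "y \<in> verts (graph_ball H x r)"
proof -
  have "(x, y) \<in> (edge_rel H)\<^sup>*"
    using assms by (auto simp: rooted_graph_def graph_connected_def)
  then obtain k where "(x, y) \<in> edge_rel H ^^ k"
    using rtrancl_imp_relpow by blast
  then show ?thesis
    using that[of k] assms by (auto simp: verts_ball rooted_graph_def)
qed

lemma rooted_iso_imp_agree:
  assumes "rooted_graph p" "rooted_graph q" "rooted_iso p q"
  shows "agree_radii p q = UNIV"
proof -
  obtain H x H' x' where pq: "p = (H, x)" "q = (H', x')" by (cases p, cases q) auto
  obtain f where f: "rooted_map f (H, x) (H', x')"
    using assms(3) by (auto simp: rooted_iso_def pq)
  have h: "multigraph H" "x \<in> verts H" and h': "multigraph H'" "x' \<in> verts H'"
    using assms by (auto simp: rooted_graph_def pq)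
  have map_path: "(x2, f y) \<in> edge_rel H2 ^^ k"
    if "rooted_map f (H1, x1) (H2, x2)" "multigraph H1" "(x1, y) \<in> edge_rel H1 ^^ k"
    for f H1 x1 H2 x2 y k using that(3)
  proof (induction k arbitrary: y)
    case 0
    then show ?case using that by (auto simp: rooted_map_def)
  next
    case (Suc k)
    then obtain z where z: "(x1, z) \<in> edge_rel H1 ^^ k" "adj H1 z y > 0"
      by (auto simp: edge_rel_def)
    have "z \<in> verts H1" "y \<in> verts H1"
      using that(2) z(2) unfolding multigraph_def by blast+
    then have "adj H2 (f z) (f y) = adj H1 z y"
      using that(1) by (simp add: rooted_map_def)
    then have "(f z, f y) \<in> edge_rel H2" using z(2) by (simp add: edge_rel_def)
    then show ?case using Suc.IH[OF z(1)] by (rule relpow_Suc_I[rotated])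
  qed
  define g where "g = inv_into (verts H) f"
  have g: "rooted_map g (H', x') (H, x)"
    using rooted_map_inv[OF f h(2)] by (simp add: g_def)
  have "r \<in> agree_radii p q" for r
  proof -
    let ?V = "verts (graph_ball H x r)" and ?V' = "verts (graph_ball H' x' r)"
    have sub: "?V \<subseteq> verts H" "?V' \<subseteq> verts H'" by (auto simp: graph_ball_def induced_def)
    have "f ` ?V \<subseteq> ?V'"
      using map_path[OF f h(1)] by (force simp: verts_ball[OF h] verts_ball[OF h'])
    moreover have "?V' \<subseteq> f ` ?V"
    proof
      fix y assume y: "y \<in> ?V'"
      then have "g y \<in> ?V"
        using map_path[OF g h'(1)] by (force simp: verts_ball[OF h] verts_ball[OF h'])
      moreover have "f (g y) = y"
        using y sub f by (auto simp: g_def rooted_map_def bij_betw_def f_inv_into_f)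
      ultimately show "y \<in> f ` ?V" by force
    qed
    ultimately have img: "f ` ?V = ?V'" by blast
    moreover have "inj_on f ?V"
      using f sub by (auto simp: rooted_map_def bij_betw_def intro: inj_on_subset)
    moreover have "adj (graph_ball H' x' r) (f y) (f z) = adj (graph_ball H x r) y z"
      if yz: "y \<in> ?V" "z \<in> ?V" for y z
    proof -
      have "f y \<in> ?V'" "f z \<in> ?V'" using yz img by auto
      moreover have "adj H' (f y) (f z) = adj H y z"
        using f sub yz by (auto simp: rooted_map_def)
      ultimately show ?thesis using yz by (simp add: adj_ball)
    qed
    ultimately have "rooted_map f (rooted_ball r p) (rooted_ball r q)"
      using f by (auto simp: rooted_map_def rooted_ball_def bij_betw_def pq)
    then show ?thesis by (auto simp: agree_radii_def rooted_iso_def)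
  qed
  then show ?thesis by auto
qed

lemma agree_imp_rooted_iso:
  assumes p: "rooted_graph p" and q: "rooted_graph q" and "agree_radii p q = UNIV"
  shows "rooted_iso p q"
proof -
  obtain H x H' x' where pq: "p = (H, x)" "q = (H', x')" by (cases p, cases q) auto
  let ?V = "\<lambda>s. verts (graph_ball H x s)" and ?V' = "\<lambda>s. verts (graph_ball H' x' s)"
  define F where "F r = {f \<in> ?V r \<rightarrow>\<^sub>E ?V' r. rooted_map f (rooted_ball r p) (rooted_ball r q)}"
    for r
  have x: "x \<in> ?V r" for r
    using root_in_ball p by (auto simp: rooted_graph_def pq)
  have finF: "finite (F r)" for r
    using finite_ball p q finite_PiE[of "?V r" "\<lambda>_. ?V' r"] by (auto simp: F_def pq)
  have restrF: "restrict f (?V r) \<in> F r"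
    if "rooted_map f (rooted_ball r p) (rooted_ball r q)" for f r
  proof -
    have b: "bij_betw f (?V r) (?V' r)"
      using that by (auto simp: rooted_map_def rooted_ball_def pq)
    then have "bij_betw (restrict f (?V r)) (?V r) (?V' r)"
      by (subst bij_betw_cong[of _ _ f]) auto
    moreover have "restrict f (?V r) \<in> ?V r \<rightarrow>\<^sub>E ?V' r"
      using b by (auto simp: bij_betw_def)
    ultimately show ?thesis
      using that x by (auto simp: rooted_map_def rooted_ball_def pq F_def)
  qed
  have restr2: "restrict f (?V s) \<in> F s" if "f \<in> F r" "s \<le> r" for f r s
    using restrF[of f s] rooted_map_ball_mono[of f r H x H' x' s] that p q
    by (auto simp: F_def pq)
  have exF: "\<exists>f. f \<in> F r" for r
  proof -
    have "r \<in> agree_radii p q" using assms(3) by simp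
    then show ?thesis using restrF by (auto simp: agree_radii_def rooted_iso_def)
  qed
  define good where "good s f \<longleftrightarrow> f \<in> F s \<and> infinite {r. s \<le> r \<and> (\<exists>g\<in>F r. restrict g (?V s) = f)}"
    for s f
  have pigeon: "\<exists>f. good s f \<and> (\<exists>r\<in>R. \<exists>g\<in>F r. s \<le> r \<and> P r g \<and> restrict g (?V s) = f)"
    if R: "infinite R" "\<And>r. r \<in> R \<Longrightarrow> s \<le> r" "\<And>r. r \<in> R \<Longrightarrow> \<exists>g\<in>F r. P r g" for R s P
  proof -
    obtain c where c: "\<And>r. r \<in> R \<Longrightarrow> c r \<in> F r \<and> P r (c r)" using R(3) by metis
    have "(\<lambda>r. restrict (c r) (?V s)) ` R \<subseteq> F s"
    proof (rule image_subsetI)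
      fix r assume "r \<in> R"
      then show "restrict (c r) (?V s) \<in> F s" using restr2[of "c r" r s] c R(2) by blast
    qed
    then have "finite ((\<lambda>r. restrict (c r) (?V s)) ` R)" using finF finite_subset by blast
    from pigeonhole_infinite[OF R(1) this] obtain r0 where r0: "r0 \<in> R"
      "infinite {r \<in> R. restrict (c r) (?V s) = restrict (c r0) (?V s)}" by auto
    have "{r \<in> R. restrict (c r) (?V s) = restrict (c r0) (?V s)} \<subseteq>
      {r. s \<le> r \<and> (\<exists>g\<in>F r. restrict g (?V s) = restrict (c r0) (?V s))}"
      using c R(2) by auto
    then have "infinite {r. s \<le> r \<and> (\<exists>g\<in>F r. restrict g (?V s) = restrict (c r0) (?V s))}"
      using r0(2) finite_subset by blast
    then have "good s (restrict (c r0) (?V s))"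
      using restr2[of "c r0" r0 s] c[OF r0(1)] R(2)[OF r0(1)] by (simp add: good_def)
    then show ?thesis using c r0(1) R(2) by blast
  qed
  have "\<exists>\<phi>. \<forall>n. good n (\<phi> n) \<and> restrict (\<phi> (Suc n)) (?V n) = \<phi> n"
  proof (rule dependent_nat_choice)
    show "\<exists>f. good 0 f"
      using pigeon[of UNIV 0 "\<lambda>_ _. True"] exF by auto
    fix f s assume "good s f"
    then have inf: "infinite {r. s \<le> r \<and> (\<exists>g\<in>F r. restrict g (?V s) = f)}" by (simp add: good_def)
    let ?R = "{r. Suc s \<le> r \<and> (\<exists>g\<in>F r. restrict g (?V s) = f)}"
    have "{r. s \<le> r \<and> (\<exists>g\<in>F r. restrict g (?V s) = f)} \<subseteq> insert s ?R"
      by (auto simp: le_less Suc_le_eq)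
    then have "infinite ?R" using inf finite_subset by blast
    then have "\<exists>f'. good (Suc s) f' \<and> (\<exists>r\<in>?R. \<exists>g\<in>F r. Suc s \<le> r \<and> restrict g (?V s) = f \<and>
        restrict g (?V (Suc s)) = f')"
      by (rule pigeon) blast+
    then obtain f' g where f': "good (Suc s) f'" "restrict g (?V s) = f" "restrict g (?V (Suc s)) = f'"
      by blast
    have "restrict f' (?V s) = f"
      unfolding f'(2)[symmetric] f'(3)[symmetric]
      using graph_ball_mono[of s "Suc s" H x] by (simp add: inf.absorb2)
    then show "\<exists>f'. good (Suc s) f' \<and> restrict f' (?V s) = f" using f'(1) by blast
  qed
  then obtain \<phi> where \<phi>: "\<And>n. \<phi> n \<in> F n" "\<And>n. restrict (\<phi> (Suc n)) (?V n) = \<phi> n"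
    by (auto simp: good_def)
  have coh: "\<phi> m y = \<phi> n y" if "n \<le> m" "y \<in> ?V n" for m n y
    using that
  proof (induction m rule: dec_induct)
    case (step m)
    have "y \<in> ?V m" using step graph_ball_mono by blast
    then have "\<phi> (Suc m) y = \<phi> m y" using \<phi>(2)[of m] by (metis restrict_apply')
    then show ?case using step by simp
  qed simp
  define f where "f y = \<phi> (LEAST n. y \<in> ?V n) y" for y
  have f: "f y = \<phi> n y" if "y \<in> ?V n" for n y
    unfolding f_def by (rule coh[symmetric]) (use that in \<open>auto intro: LeastI Least_le\<close>)
  have bij: "bij_betw f (?V n) (?V' n)"
    and adj: "\<And>y z. y \<in> ?V n \<Longrightarrow> z \<in> ?V n \<Longrightarrow> adj H' (f y) (f z) = adj H y z" for n
  proof -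
    have m: "bij_betw (\<phi> n) (?V n) (?V' n)"
      "\<And>y z. y \<in> ?V n \<Longrightarrow> z \<in> ?V n \<Longrightarrow>
        adj (graph_ball H' x' n) (\<phi> n y) (\<phi> n z) = adj (graph_ball H x n) y z"
      using \<phi>(1)[of n] by (auto simp: F_def rooted_map_def rooted_ball_def pq)
    show "bij_betw f (?V n) (?V' n)" using m(1) f by (subst bij_betw_cong) auto
    fix y z assume yz: "y \<in> ?V n" "z \<in> ?V n"
    then have "\<phi> n y \<in> ?V' n" "\<phi> n z \<in> ?V' n" using m(1) by (auto simp: bij_betw_def)
    then show "adj H' (f y) (f z) = adj H y z"
      using m(2)[OF yz] yz by (simp add: f adj_ball)
  qed
  have cover: "\<exists>n. y \<in> ?V n \<and> z \<in> ?V n" if yz: "y \<in> verts H" "z \<in> verts H" for y z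
  proof -
    obtain m n where "y \<in> ?V m" "z \<in> ?V n"
      using in_verts_ball p yz unfolding pq by metis
    then show ?thesis
      using graph_ball_mono[of m "max m n" H x] graph_ball_mono[of n "max m n" H x] by auto
  qed
  have "inj_on f (verts H)"
  proof (rule inj_onI)
    fix y z assume yz: "y \<in> verts H" "z \<in> verts H" "f y = f z"
    then obtain n where "y \<in> ?V n" "z \<in> ?V n" using cover by blast
    then show "y = z" using bij[of n] yz(3) by (auto simp: bij_betw_def dest: inj_onD)
  qed
  moreover have "f ` verts H = verts H'"
  proof
    show "f ` verts H \<subseteq> verts H'"
    proof
      fix z assume "z \<in> f ` verts H"
      then obtain y where y: "y \<in> verts H" "z = f y" by blast
      then obtain n where "y \<in> ?V n" using cover by blast
      then have "z \<in> ?V' n" using bij[of n] y by (auto simp: bij_betw_def)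
      then show "z \<in> verts H'" by (auto simp: graph_ball_def induced_def)
    qed
    show "verts H' \<subseteq> f ` verts H"
    proof
      fix z assume "z \<in> verts H'"
      then obtain n where "z \<in> ?V' n" using in_verts_ball q unfolding pq by metis
      then obtain y where "y \<in> ?V n" "z = f y" using bij[of n] by (auto simp: bij_betw_def)
      then show "z \<in> f ` verts H" by (auto simp: graph_ball_def induced_def)
    qed
  qed
  moreover have "f x = x'"
    using \<phi>(1)[of 0] f[OF x] by (auto simp: F_def rooted_map_def rooted_ball_def pq)
  moreover have "adj H' (f y) (f z) = adj H y z" if "y \<in> verts H" "z \<in> verts H" for y z
    using cover[OF that] adj by blast
  ultimately have "rooted_map f p q"
    by (auto simp: rooted_map_def pq bij_betw_def)
  then show ?thesis by (auto simp: rooted_iso_def)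
qed

text \<open>The metric takes the value \<open>0\<close> when the balls of all radii agree, as \<open>1 / \<infinity> = 0\<close>.\<close>

definition rooted_dist :: "mgraph \<times> nat \<Rightarrow> mgraph \<times> nat \<Rightarrow> real" where
  "rooted_dist p q = enn2real (1 / (1 + (SUP r\<in>agree_radii p q. ennreal (real r))))"

lemma agree_radii_trans: "agree_radii p q \<inter> agree_radii q s \<subseteq> agree_radii p s"
  unfolding agree_radii_def using rooted_iso_trans by blast

lemma root_in_rooted_ball:
  "rooted_graph p \<Longrightarrow> snd (rooted_ball r p) \<in> verts (fst (rooted_ball r p))"
  by (cases p) (auto simp: rooted_ball_def rooted_graph_def root_in_ball)

lemma agree_radii_sym:
  assumes "rooted_graph p" "rooted_graph q"
  shows "agree_radii p q = agree_radii q p"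
  unfolding agree_radii_def using assms rooted_iso_sym root_in_rooted_ball by blast

lemma rooted_equiv_agree:
  assumes "rooted_equiv p p'" "rooted_equiv q q'"
  shows "agree_radii p q = agree_radii p' q'"
proof -
  have "agree_radii p p' = UNIV" "agree_radii p' p = UNIV"
       "agree_radii q q' = UNIV" "agree_radii q' q = UNIV"
    using assms rooted_iso_imp_agree rooted_iso_sym root_in_verts
    unfolding rooted_equiv_def by blast+
  then show ?thesis
    using agree_radii_trans[of p p' q'] agree_radii_trans[of p q' q]
      agree_radii_trans[of p' p q] agree_radii_trans[of p' q q'] by auto
qed

lemma ennreal_inverse_antimono: "(a :: ennreal) \<le> b \<Longrightarrow> inverse b \<le> inverse a"
  including ennreal.lifting by transfer (auto intro: ereal_inverse_antimono)

lemma rooted_dist_antimono: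
  assumes "agree_radii p q \<subseteq> agree_radii p' q'"
  shows "rooted_dist p' q' \<le> rooted_dist p q"
proof -
  have "(SUP r\<in>agree_radii p q. ennreal (real r)) \<le> (SUP r\<in>agree_radii p' q'. ennreal (real r))"
    using assms by (rule SUP_subset_mono) simp
  then have "1 / (1 + (SUP r\<in>agree_radii p' q'. ennreal (real r)))
      \<le> 1 / (1 + (SUP r\<in>agree_radii p q. ennreal (real r)))"
    by (simp add: divide_ennreal_def ennreal_inverse_antimono add_left_mono)
  moreover have "1 / (1 + s) < \<infinity>" for s :: ennreal
    by (simp add: divide_ennreal_def less_top[symmetric])
  ultimately show ?thesis unfolding rooted_dist_def by (intro enn2real_mono) simp_all
qed

lemma rooted_dist_0_iff:
  assumes "rooted_graph p" "rooted_graph q"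
  shows "rooted_dist p q = 0 \<longleftrightarrow> rooted_iso p q"
proof
  assume "rooted_iso p q"
  then have "agree_radii p q = UNIV" using assms rooted_iso_imp_agree by blast
  moreover have "(SUP r. ennreal (real r)) = (\<infinity> :: ennreal)"
    using ennreal_SUP_of_nat_eq_top by (simp add: ennreal_of_nat_eq_real_of_nat)
  ultimately have "rooted_dist p q = enn2real (1 / (1 + \<infinity>))" unfolding rooted_dist_def by (simp only:)
  then show "rooted_dist p q = 0" by (simp add: divide_ennreal_def)
next
  assume 0: "rooted_dist p q = 0"
  have "r \<in> agree_radii p q" for r
  proof (rule ccontr)
    assume "r \<notin> agree_radii p q"
    then have "s \<le> r" if "s \<in> agree_radii p q" for s
      using agree_radii_downward[OF assms that, of r] by (meson nle_le)
    then have "(SUP r\<in>agree_radii p q. ennreal (real r)) \<le> ennreal (real r)"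
      by (intro SUP_least) (simp add: ennreal_leI)
    then obtain t where t: "t \<ge> 0" "(SUP r\<in>agree_radii p q. ennreal (real r)) = ennreal t"
      by (cases "SUP r\<in>agree_radii p q. ennreal (real r)") (auto simp: top_unique)
    then have "rooted_dist p q = enn2real (ennreal (1 / (1 + t)))"
      unfolding rooted_dist_def
      by (simp add: divide_ennreal flip: ennreal_1 ennreal_plus)
    also have "\<dots> = 1 / (1 + t)" using t by (intro enn2real_ennreal) simp
    finally show False using 0 t by simp
  qed
  then show "rooted_iso p q" using assms agree_imp_rooted_iso by blast
qed

instantiation rgraph :: metric_space
begin

lift_definition dist_rgraph :: "rgraph \<Rightarrow> rgraph \<Rightarrow> real" is rooted_dist
  unfolding rooted_dist_def using rooted_equiv_agree by simp

definition uniformity_rgraph :: "(rgraph \<times> rgraph) filter" where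
  "uniformity_rgraph = (INF e\<in>{0<..}. principal {(x, y). dist x y < e})"

definition open_rgraph :: "rgraph set \<Rightarrow> bool" where
  "open_rgraph U \<longleftrightarrow> (\<forall>x\<in>U. eventually (\<lambda>(x', y). x' = x \<longrightarrow> y \<in> U) uniformity)"

instance
proof
  show "(dist x y = 0) = (x = y)" for x y :: rgraph
    by transfer (auto simp: rooted_dist_0_iff rooted_equiv_def)
  show "dist x y \<le> dist x z + dist y z" for x y z :: rgraph
  proof transfer
    fix p q s assume "rooted_equiv p p" "rooted_equiv q q" "rooted_equiv s s"
    then have P: "rooted_graph p" "rooted_graph q" "rooted_graph s"
      by (auto simp: rooted_equiv_def)
    have tr: "agree_radii p s \<inter> agree_radii q s \<subseteq> agree_radii p q"
      using agree_radii_trans agree_radii_sym P by metis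
    have "agree_radii p s \<subseteq> agree_radii q s \<or> agree_radii q s \<subseteq> agree_radii p s"
    proof (rule ccontr)
      assume "\<not> ?thesis"
      then obtain a b where "a \<in> agree_radii p s" "a \<notin> agree_radii q s"
        "b \<in> agree_radii q s" "b \<notin> agree_radii p s" by blast
      then show False using agree_radii_downward P by (meson nle_le)
    qed
    then have "rooted_dist p q \<le> rooted_dist p s \<or> rooted_dist p q \<le> rooted_dist q s"
      using tr rooted_dist_antimono by (metis Int_absorb1 Int_absorb2)
    moreover have "rooted_dist p s \<ge> 0" "rooted_dist q s \<ge> 0"
      by (auto simp: rooted_dist_def)
    ultimately show "rooted_dist p q \<le> rooted_dist p s + rooted_dist q s" by linarith
  qed
qed (simp_all add: uniformity_rgraph_def open_rgraph_def)

end

lemma rooted_map_degree: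
  assumes "rooted_map f (H, x) (H', x')" "multigraph H" "multigraph H'" "x \<in> verts H"
  shows "vertex_degree H' x' = vertex_degree H x"
proof -
  have bij: "bij_betw f (verts H) (verts H')" and fx: "f x = x'"
    and adj: "\<And>y z. y \<in> verts H \<Longrightarrow> z \<in> verts H \<Longrightarrow> adj H' (f y) (f z) = adj H y z"
    using assms by (auto simp: rooted_map_def)
  have sub: "{y. adj H x y > 0} \<subseteq> verts H" "{y. adj H' x' y > 0} \<subseteq> verts H'"
    using assms by (auto simp: multigraph_def)
  have "f ` {y. adj H x y > 0} = {y. adj H' x' y > 0}"
  proof
    show "f ` {y. adj H x y > 0} \<subseteq> {y. adj H' x' y > 0}"
      using sub adj[OF assms(4)] fx by auto
    show "{y. adj H' x' y > 0} \<subseteq> f ` {y. adj H x y > 0}"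
    proof
      fix z assume z: "z \<in> {y. adj H' x' y > 0}"
      then obtain y where y: "y \<in> verts H" "z = f y"
        using sub bij unfolding bij_betw_def by blast
      then show "z \<in> f ` {y. adj H x y > 0}" using z adj[OF assms(4) y(1)] fx by auto
    qed
  qed
  moreover have "inj_on f {y. adj H x y > 0}"
    using bij sub by (meson bij_betw_def inj_on_subset)
  ultimately have "bij_betw f {y. adj H x y > 0} {y. adj H' x' y > 0}"
    by (simp add: bij_betw_def)
  then have "vertex_degree H' x' = (\<Sum>y | adj H x y > 0. adj H' x' (f y))"
    unfolding vertex_degree_def by (rule sum.reindex_bij_betw[symmetric])
  also have "\<dots> = vertex_degree H x"
    unfolding vertex_degree_def using sub adj[OF assms(4)] fx by (intro sum.cong) auto
  finally show ?thesis .
qed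

lift_definition root_degree :: "rgraph \<Rightarrow> nat" is "\<lambda>(H, x). vertex_degree H x"
  using rooted_map_degree
  by (fastforce simp: rooted_equiv_def rooted_iso_def rooted_graph_def)

definition nontrivial_rooted_tree :: "mgraph \<times> nat \<Rightarrow> bool" where
  "nontrivial_rooted_tree = (\<lambda>(H, x). tree H \<and> (\<exists>y\<in>verts H. y \<noteq> x))"

lemma rooted_map_tree:
  assumes f: "rooted_map f (H, x) (H', x')"
    and H: "rooted_graph (H, x)" and H': "rooted_graph (H', x')"
    and t: "nontrivial_rooted_tree (H', x')"
  shows "nontrivial_rooted_tree (H, x)"
proof -
  have bij: "bij_betw f (verts H) (verts H')" and fx: "f x = x'"
    and adj: "\<And>y z. y \<in> verts H \<Longrightarrow> z \<in> verts H \<Longrightarrow> adj H' (f y) (f z) = adj H y z"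
    using f by (auto simp: rooted_map_def)
  have le: "adj H y z \<le> adj H' (f y) (f z)" for y z
    using adj[of y z] H by (cases "adj H y z > 0") (auto simp: rooted_graph_def multigraph_def)
  have "adj H y y = 0" for y
    using le[of y y] t by (auto simp: nontrivial_rooted_tree_def tree_def loopless_def)
  moreover have "adj H y z \<le> 1" for y z
    using le[of y z] t by (auto simp: nontrivial_rooted_tree_def tree_def intro: order_trans)
  moreover have "\<not> cycle H xs" for xs
  proof
    assume c: "cycle H xs"
    have len: "length xs > 0" using c by (auto simp: cycle_def)
    have "cycle H' (map f xs)"
      unfolding cycle_def
    proof (intro conjI allI impI)
      show "3 \<le> length (map f xs)" using c by (simp add: cycle_def)
      show "distinct (map f xs)"
        using c bij by (auto simp: cycle_def distinct_map bij_betw_def intro: inj_on_subset)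
      show "set (map f xs) \<subseteq> verts H'" using c bij by (auto simp: cycle_def bij_betw_def)
      fix i assume i: "i < length (map f xs)"
      have "adj H (xs ! i) (xs ! (Suc i mod length xs)) > 0"
        using c i by (simp add: cycle_def)
      then have "adj H' (f (xs ! i)) (f (xs ! (Suc i mod length xs))) > 0"
        using le order.strict_trans2 by blast
      then show "0 < adj H' (map f xs ! i) (map f xs ! (Suc i mod length (map f xs)))"
        using i len by simp
    qed
    then show False using t by (auto simp: nontrivial_rooted_tree_def tree_def)
  qed
  moreover have "\<exists>y\<in>verts H. y \<noteq> x"
    using t bij fx by (fastforce simp: nontrivial_rooted_tree_def bij_betw_def)
  ultimately show ?thesis
    using H by (auto simp: nontrivial_rooted_tree_def tree_def loopless_def rooted_graph_def)
qed

lift_definition is_nontrivial_tree :: "rgraph \<Rightarrow> bool" is nontrivial_rooted_tree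
proof -
  fix p q assume "rooted_equiv p q"
  then have "rooted_graph p" "rooted_graph q" "rooted_iso p q" "rooted_iso q p"
    using rooted_iso_sym root_in_verts by (auto simp: rooted_equiv_def)
  then show "nontrivial_rooted_tree p = nontrivial_rooted_tree q"
    using rooted_map_tree unfolding rooted_iso_def by (metis prod.collapse)
qed

text \<open>The point of the space represented by the component of \<open>x\<close>, rooted at \<open>x\<close>.\<close>

definition component_at :: "mgraph \<Rightarrow> nat \<Rightarrow> rgraph" where
  "component_at H x = abs_rgraph (component H x, x)"


section \<open>Random graphs and modes of convergence\<close>

text \<open>
  A random multigraph on a finite vertex set \<open>V\<close> is determined by the finitely many edge numbers,
  whence the form of the measurability condition.
\<close>

definition random_multigraph :: "'a measure \<Rightarrow> nat set \<Rightarrow> ('a \<Rightarrow> mgraph) \<Rightarrow> bool" where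
  "random_multigraph M V G \<longleftrightarrow> prob_space M \<and>
     (\<forall>\<omega>\<in>space M. multigraph (G \<omega>) \<and> verts (G \<omega>) = V) \<and>
     (\<forall>x y. (\<lambda>\<omega>. adj (G \<omega>) x y) \<in> measurable M (count_space UNIV))"

text \<open>The random variables \<open>X n\<close> live on different spaces \<open>M n\<close>; the limit is a constant.\<close>

definition conv_in_prob :: "(nat \<Rightarrow> 'a measure) \<Rightarrow> (nat \<Rightarrow> 'a \<Rightarrow> real) \<Rightarrow> real \<Rightarrow> bool" where
  "conv_in_prob M X c \<longleftrightarrow>
     (\<forall>\<epsilon>>0. (\<lambda>n. measure (M n) {\<omega>\<in>space (M n). \<bar>X n \<omega> - c\<bar> > \<epsilon>}) \<longlonglongrightarrow> 0)"

definition weak_conv_in_prob ::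
  "(nat \<Rightarrow> 'a measure) \<Rightarrow> (nat \<Rightarrow> 'a \<Rightarrow> real measure) \<Rightarrow> real measure \<Rightarrow> bool" where
  "weak_conv_in_prob M \<nu> \<mu> \<longleftrightarrow>
     (\<forall>f :: real \<Rightarrow> real. continuous_on UNIV f \<and> bounded (range f) \<longrightarrow>
        conv_in_prob M (\<lambda>n \<omega>. \<integral>x. f x \<partial>\<nu> n \<omega>) (\<integral>x. f x \<partial>\<mu>))"

definition locally_conv_in_prob ::
  "(nat \<Rightarrow> 'a measure) \<Rightarrow> (nat \<Rightarrow> 'a \<Rightarrow> mgraph) \<Rightarrow> rgraph measure \<Rightarrow> bool" where
  "locally_conv_in_prob M G \<Lambda> \<longleftrightarrow>
     (\<forall>h :: rgraph \<Rightarrow> real. continuous_on UNIV h \<and> bounded (range h) \<longrightarrow>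
        conv_in_prob M (\<lambda>n \<omega>. (\<Sum>i\<in>{1..n}. h (component_at (G n \<omega>) i)) / real n)
          (\<integral>x. h x \<partial>\<Lambda>))"

text \<open>For families of non-negative random variables.\<close>

definition uniformly_integrable ::
  "'i set \<Rightarrow> ('i \<Rightarrow> 'a measure) \<Rightarrow> ('i \<Rightarrow> 'a \<Rightarrow> real) \<Rightarrow> bool" where
  "uniformly_integrable I M X \<longleftrightarrow>
     ((\<lambda>K :: real. SUP i\<in>I. \<integral>\<^sup>+\<omega>. ennreal (X i \<omega>) * indicator {\<omega>. X i \<omega> > K} \<omega> \<partial>M i) \<longlongrightarrow> 0) at_top"

text \<open>
  The measure \<open>1/n \<Sum>\<^sub>i \<delta>\<^bsub>a i\<^esub>\<close>, as the image of the uniform distribution on \<open>{1..n}\<close>; see the lemma.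
\<close>

definition empirical_measure :: "nat \<Rightarrow> (nat \<Rightarrow> real) \<Rightarrow> real measure" where
  "empirical_measure n a = distr (uniform_count_measure {1..n}) borel a"

lemma emeasure_empirical_measure:
  assumes "n \<ge> 1" "B \<in> sets borel"
  shows "emeasure (empirical_measure n a) B =
    (\<Sum>i\<in>{1..n}. emeasure (return borel (a i)) B) / of_nat n"
proof -
  have "emeasure (empirical_measure n a) B =
      emeasure (uniform_count_measure {1..n}) (a -` B \<inter> {1..n})"
    unfolding empirical_measure_def using assms
    by (subst emeasure_distr)
       (auto simp: space_uniform_count_measure sets_uniform_count_measure_count_space measurable_def
          sets_uniform_count_measure)
  also have "\<dots> = of_nat (card (a -` B \<inter> {1..n})) / of_nat n"
    using assms by (subst emeasure_uniform_count_measure)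
      (auto simp: ennreal_of_nat_eq_real_of_nat divide_ennreal)
  also have "of_nat (card (a -` B \<inter> {1..n})) = (\<Sum>i\<in>{1..n}. emeasure (return borel (a i)) B)"
    using assms by (auto simp: indicator_def sum.If_cases Int_def conj_commute intro!: arg_cong[where f=card])
  finally show ?thesis .
qed


section \<open>Lazy exploration\<close>

text \<open>Matrix indices start at \<open>0\<close>: vertex \<open>i \<in> {1..n}\<close> has index \<open>i - 1\<close>.\<close>

definition transition_matrix :: "nat \<Rightarrow> mgraph \<Rightarrow> real mat" where
  "transition_matrix n H =
     mat n n (\<lambda>(i, j). real (adj H (Suc i) (Suc j)) / real (vertex_degree H (Suc i)))"

definition lazy_matrix :: "real \<Rightarrow> nat \<Rightarrow> nat \<Rightarrow> mgraph \<Rightarrow> real mat" where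
  "lazy_matrix \<delta> n k H = (\<delta> \<cdot>\<^sub>m 1\<^sub>m n + (1 - \<delta>) \<cdot>\<^sub>m transition_matrix n H) ^\<^sub>m k"

definition Delta_lazy :: "real \<Rightarrow> nat \<Rightarrow> nat \<Rightarrow> mgraph \<Rightarrow> nat \<Rightarrow> real" where
  "Delta_lazy \<delta> n k H i =
     (\<Sum>j\<in>{1..n}. lazy_matrix \<delta> n k H $$ (i - 1, j - 1) * real (vertex_degree H j)) - real (vertex_degree H i)"

definition mu_lazy :: "real \<Rightarrow> nat \<Rightarrow> nat \<Rightarrow> mgraph \<Rightarrow> real measure" where
  "mu_lazy \<delta> n k H = empirical_measure n (Delta_lazy \<delta> n k H)"

definition pi_c :: "mgraph \<Rightarrow> nat \<Rightarrow> real" where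
  "pi_c H i = real (vertex_degree H i) / (\<Sum>j\<in>verts (component H i). real (vertex_degree H j))"

text \<open>
  The stationary law of the walk started at \<open>i\<close> is \<open>pi_c\<close> on the component \<open>C\<^sub>i\<close> and gives mass \<open>0\<close> to the
  other vertices, so its integral only involves \<open>j \<in> V(C\<^sub>i)\<close>.  On \<open>[n]\<close> the weights \<open>pi_c\<close> add up to
  the number of components.
\<close>

definition Delta_st :: "mgraph \<Rightarrow> nat \<Rightarrow> real" where
  "Delta_st H i =
     (\<Sum>j\<in>verts (component H i). pi_c H j * real (vertex_degree H j)) - real (vertex_degree H i)"

definition mu_st :: "nat \<Rightarrow> mgraph \<Rightarrow> real measure" where
  "mu_st n H = empirical_measure n (Delta_st H)"

definition root_moment :: "nat \<Rightarrow> rgraph measure \<Rightarrow> real" where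
  "root_moment p \<Lambda> = (\<integral>x. real (root_degree x) ^ p \<partial>\<Lambda>)"

definition mu_limit :: "rgraph measure \<Rightarrow> real measure" where
  "mu_limit \<Lambda> =
     distr \<Lambda> borel (\<lambda>x. root_moment 2 \<Lambda> / root_moment 1 \<Lambda> - real (root_degree x))"

end

theory Submission
  imports Defs
begin

text \<open>
  Part (a) is a statement about one finite graph.  One lazy step replaces a function \<open>f\<close> on the
  vertices by \<open>Q f\<close>, where \<open>(Q f) x = \<delta> f x + (1 - \<delta>) (P f) x\<close>.  In the norm weighted by degrees,
  convexity of the square and reversibility give
  \<open>\<parallel>Q f\<parallel>\<^sup>2 \<le> \<parallel>f\<parallel>\<^sup>2 - \<delta> (1 - \<delta>) E f\<close> with the Dirichlet energy
  \<open>E f = \<Sum> A\<^sub>x\<^sub>y (f x - f y)\<^sup>2\<close> (\<open>lazy_step_dissipates\<close>).  The squared norms of \<open>Q\<^sup>k f\<close> decrease and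
  converge, so \<open>E (Q\<^sup>k f)\<close> tends to \<open>0\<close>: asymptotically \<open>Q\<^sup>k f\<close> is constant on every component.
  Its degree-weighted sum over a component never changes, so the constant is the mean of \<open>f\<close> under
  the stationary law of the component (\<open>lazy_walk_tendsto_mean\<close>).  With \<open>f\<close> the degree it yields convergence of every atom of
  \<open>mu_lazy\<close>, hence weak convergence.

  For part (b), on a connected graph the shift \<open>\<Sum> \<pi> j d\<^sub>j\<close> is the same for all vertices, namely the
  ratio \<open>Y\<^sub>n\<close> of the averages of \<open>d\<^sub>i\<^sup>2\<close> and of \<open>d\<^sub>i\<close>.  The root degree is locally constant on the
  space of rooted graphs, so every bounded function of it is a continuous test function, and local
  convergence gives a law of large numbers for averages of bounded functions of the degrees.
  Uniform integrability makes the average of \<open>d\<^sub>i\<^sup>2\<close> over degrees above a level \<open>K\<close> small with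
  probability close to \<open>1\<close>, uniformly in \<open>n\<close> (\<open>uniform_tail\<close>).  This shows that the limiting second
  moment is finite and extends the law of large numbers to functions dominated by \<open>d\<^sup>2\<close>
  (\<open>degree_avg_conv\<close>).  Hence \<open>Y\<^sub>n\<close> converges to \<open>c = m\<^sup>(\<^sup>2\<^sup>) / m\<^sup>(\<^sup>1\<^sup>)\<close>, where \<open>m\<^sup>(\<^sup>1\<^sup>) \<ge> 1\<close> because the
  root of a non-trivial tree has a neighbour.  Finally \<open>Y\<^sub>n\<close> can be replaced by \<open>c\<close> in the average of
  \<open>f (Y\<^sub>n - d\<^sub>i)\<close>: for bounded degrees by uniform continuity of \<open>f\<close> on a compact interval, and large
  degrees are rare because the average degree is bounded (\<open>avg_shift_close\<close>).
\<close>

section \<open>Lazy walks on finite weighted networks\<close>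

text \<open>
  The edge weights stand for the adjacency numbers of a multigraph.
  Symmetry of \<open>w\<close> is the reversibility of the walk with respect to \<open>weight\<close>.
\<close>
locale finite_network =
  fixes V :: "'v set" and w :: "'v \<Rightarrow> 'v \<Rightarrow> real"
  assumes finite_V: "finite V"
    and w_sym: "w x y = w y x"
    and w_nonneg: "0 \<le> w x y"
    and sum_w_pos: "x \<in> V \<Longrightarrow> 0 < (\<Sum>y\<in>V. w x y)"
begin

definition weight :: "'v \<Rightarrow> real" where
  "weight x = (\<Sum>y\<in>V. w x y)"

definition lazy_step :: "real \<Rightarrow> ('v \<Rightarrow> real) \<Rightarrow> 'v \<Rightarrow> real" where
  "lazy_step \<delta> f x = \<delta> * f x + (1 - \<delta>) * ((\<Sum>y\<in>V. w x y * f y) / weight x)"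

definition sqnorm :: "('v \<Rightarrow> real) \<Rightarrow> real" where
  "sqnorm f = (\<Sum>x\<in>V. weight x * (f x)\<^sup>2)"

definition energy :: "('v \<Rightarrow> real) \<Rightarrow> real" where
  "energy f = (\<Sum>x\<in>V. \<Sum>y\<in>V. w x y * (f x - f y)\<^sup>2)"

definition links :: "('v \<times> 'v) set" where
  "links = {(x, y). x \<in> V \<and> y \<in> V \<and> w x y > 0}"

lemma weight_pos: "x \<in> V \<Longrightarrow> 0 < weight x"
  using sum_w_pos by (simp add: weight_def)

lemma sqnorm_nonneg: "0 \<le> sqnorm f"
  unfolding sqnorm_def using weight_pos by (intro sum_nonneg mult_nonneg_nonneg) (auto intro: less_imp_le)

lemma lazy_step_eq_average:
  assumes "x \<in> V"
  shows "weight x * lazy_step \<delta> f x = (\<Sum>y\<in>V. w x y * (\<delta> * f x + (1 - \<delta>) * f y))"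
proof -
  have "weight x * lazy_step \<delta> f x = \<delta> * f x * weight x + (1 - \<delta>) * (\<Sum>y\<in>V. w x y * f y)"
    using weight_pos[OF assms] by (simp add: lazy_step_def field_simps)
  also have "\<dots> = (\<Sum>y\<in>V. \<delta> * f x * w x y + (1 - \<delta>) * (w x y * f y))"
    by (simp only: weight_def sum_distrib_left sum.distrib)
  also have "\<dots> = (\<Sum>y\<in>V. w x y * (\<delta> * f x + (1 - \<delta>) * f y))"
    by (simp add: algebra_simps)
  finally show ?thesis .
qed

text \<open>
  Jensen's inequality for the square, multiplied by the total weight: \<open>a\<close> is the \<open>w x\<close>-average
  of \<open>u\<close>.
\<close>
lemma weighted_square_le:
  assumes "x \<in> V" and u: "weight x * a = (\<Sum>y\<in>V. w x y * u y)"
  shows "weight x * a\<^sup>2 \<le> (\<Sum>y\<in>V. w x y * (u y)\<^sup>2)"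
proof -
  have "(weight x * a)\<^sup>2 = (\<Sum>y\<in>V. sqrt (w x y) * (sqrt (w x y) * u y))\<^sup>2"
    using w_nonneg by (simp add: u mult.assoc[symmetric])
  also have "\<dots> \<le> (\<Sum>y\<in>V. (sqrt (w x y))\<^sup>2) * (\<Sum>y\<in>V. (sqrt (w x y) * u y)\<^sup>2)"
    by (rule Cauchy_Schwarz_ineq_sum)
  also have "\<dots> = weight x * (\<Sum>y\<in>V. w x y * (u y)\<^sup>2)"
    using w_nonneg by (simp add: weight_def power_mult_distrib)
  finally have "weight x * (weight x * a\<^sup>2) \<le> weight x * (\<Sum>y\<in>V. w x y * (u y)\<^sup>2)"
    by (simp add: power2_eq_square mult_ac)
  then show ?thesis
    using weight_pos[OF assms(1)] by simp
qed

text \<open>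
  The double sum on the left does not depend on which end of the edge carries \<open>g\<close>; this is where
  reversibility is used.
\<close>
lemma sum_weight_swap: "(\<Sum>x\<in>V. \<Sum>y\<in>V. w x y * g y) = (\<Sum>x\<in>V. weight x * g x)"
proof -
  have "(\<Sum>x\<in>V. \<Sum>y\<in>V. w x y * g y) = (\<Sum>y\<in>V. \<Sum>x\<in>V. w y x * g y)"
    using w_sym by (subst sum.swap) (intro sum.cong refl, metis)
  then show ?thesis by (simp add: weight_def sum_distrib_right)
qed

text \<open>
  The lazy average is an average over neighbours \<open>y\<close> of \<open>\<delta> f x + (1 - \<delta>) f y\<close>, whose square is
  \<open>\<delta> (f x)\<^sup>2 + (1 - \<delta>) (f y)\<^sup>2 - \<delta> (1 - \<delta>) (f x - f y)\<^sup>2\<close>.  Summing over all edges turns each of the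
  first two squares into \<open>sqnorm f\<close>, while the mixed term, nonzero for \<open>0 < \<delta> < 1\<close>, is the loss.
\<close>
lemma lazy_step_dissipates:
  "sqnorm (lazy_step \<delta> f) \<le> sqnorm f - \<delta> * (1 - \<delta>) * energy f"
proof -
  have "sqnorm (lazy_step \<delta> f) \<le> (\<Sum>x\<in>V. \<Sum>y\<in>V. w x y * (\<delta> * f x + (1 - \<delta>) * f y)\<^sup>2)"
    unfolding sqnorm_def
    by (intro sum_mono weighted_square_le) (simp_all add: lazy_step_eq_average)
  also have "\<dots> = (\<Sum>x\<in>V. \<Sum>y\<in>V. \<delta> * (w x y * (f x)\<^sup>2) + (1 - \<delta>) * (w x y * (f y)\<^sup>2)
      - \<delta> * (1 - \<delta>) * (w x y * (f x - f y)\<^sup>2))"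
    by (intro sum.cong refl) (simp add: power2_eq_square algebra_simps)
  also have "\<dots> = \<delta> * (\<Sum>x\<in>V. \<Sum>y\<in>V. w x y * (f x)\<^sup>2) + (1 - \<delta>) * (\<Sum>x\<in>V. \<Sum>y\<in>V. w x y * (f y)\<^sup>2)
      - \<delta> * (1 - \<delta>) * energy f"
    by (simp only: energy_def sum.distrib sum_subtractf sum_distrib_left)
  also have "(\<Sum>x\<in>V. \<Sum>y\<in>V. w x y * (f y)\<^sup>2) = sqnorm f"
    by (simp add: sum_weight_swap sqnorm_def)
  also have "(\<Sum>x\<in>V. \<Sum>y\<in>V. w x y * (f x)\<^sup>2) = sqnorm f"
    by (simp add: sqnorm_def weight_def sum_distrib_right)
  finally show ?thesis by (simp add: algebra_simps)
qed

lemma link_le_energy: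
  assumes "x \<in> V" "y \<in> V"
  shows "w x y * (f x - f y)\<^sup>2 \<le> energy f"
proof -
  have "w x y * (f x - f y)\<^sup>2 \<le> (\<Sum>y\<in>V. w x y * (f x - f y)\<^sup>2)"
    using assms finite_V w_nonneg by (intro member_le_sum) auto
  also have "\<dots> \<le> energy f"
    unfolding energy_def
    using assms finite_V w_nonneg by (intro member_le_sum[where f="\<lambda>x. \<Sum>y\<in>V. w x y * (f x - f y)\<^sup>2"] sum_nonneg) auto
  finally show ?thesis .
qed

lemma energy_nonneg: "0 \<le> energy f"
  unfolding energy_def using w_nonneg by (intro sum_nonneg) auto

text \<open>
  The energy is dominated by the decrements of the squared norm, a decreasing sequence bounded
  below by \<open>0\<close>.
\<close>
lemma energy_tendsto_0:
  assumes "0 < \<delta>" "\<delta> < 1"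
  shows "(\<lambda>k. energy ((lazy_step \<delta> ^^ k) f)) \<longlonglongrightarrow> 0"
proof -
  let ?s = "\<lambda>k. sqnorm ((lazy_step \<delta> ^^ k) f)" and ?e = "\<lambda>k. energy ((lazy_step \<delta> ^^ k) f)"
  have pos: "0 < \<delta> * (1 - \<delta>)" using assms by simp
  have step: "\<delta> * (1 - \<delta>) * ?e k \<le> ?s k - ?s (Suc k)" for k
    using lazy_step_dissipates[of \<delta> "(lazy_step \<delta> ^^ k) f"] by simp
  have "?s (Suc k) \<le> ?s k" for k
    using step[of k] mult_nonneg_nonneg[OF less_imp_le[OF pos] energy_nonneg] by (smt (verit))
  then have "decseq ?s" by (rule decseq_SucI)
  then obtain L where L: "?s \<longlonglongrightarrow> L"
    using decseq_convergent[of ?s 0] sqnorm_nonneg by blast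
  then have "(\<lambda>k. (?s k - ?s (Suc k)) / (\<delta> * (1 - \<delta>))) \<longlonglongrightarrow> (L - L) / (\<delta> * (1 - \<delta>))"
    using pos LIMSEQ_Suc[OF L] by (intro tendsto_intros) auto
  then have lim: "(\<lambda>k. (?s k - ?s (Suc k)) / (\<delta> * (1 - \<delta>))) \<longlonglongrightarrow> 0" by simp
  show ?thesis
    using step pos energy_nonneg
    by (intro tendsto_sandwich[OF _ _ tendsto_const lim] always_eventually allI)
       (auto simp: pos_le_divide_eq mult_ac)
qed

lemma linked_values_merge:
  assumes "0 < \<delta>" "\<delta> < 1" and "(x, y) \<in> links\<^sup>*"
  shows "(\<lambda>k. (lazy_step \<delta> ^^ k) f x - (lazy_step \<delta> ^^ k) f y) \<longlonglongrightarrow> 0"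
  using assms(3)
proof induction
  case (step y z)
  let ?f = "\<lambda>k. (lazy_step \<delta> ^^ k) f"
  have yz: "y \<in> V" "z \<in> V" "w y z > 0" using step by (auto simp: links_def)
  have lim: "(\<lambda>k. energy (?f k) / w y z) \<longlonglongrightarrow> 0"
    using energy_tendsto_0[OF assms(1,2), of f] by (rule tendsto_divide_zero)
  have "(?f k y - ?f k z)\<^sup>2 \<le> energy (?f k) / w y z" for k
    using link_le_energy[OF yz(1,2), of "?f k"] yz(3) by (simp add: pos_le_divide_eq mult.commute)
  then have "(\<lambda>k. (?f k y - ?f k z)\<^sup>2) \<longlonglongrightarrow> 0"
    by (intro tendsto_sandwich[OF _ _ tendsto_const lim] always_eventually allI) auto
  then have "(\<lambda>k. ?f k y - ?f k z) \<longlonglongrightarrow> 0" by simp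
  from tendsto_add[OF step.IH this] show ?case by simp
qed simp

text \<open>
  A union of components is itself a network with the same weights, and on it the step preserves
  the weighted sum since \<open>weight\<close> is a stationary measure.
\<close>
lemma weighted_sum_conserved:
  assumes "C \<subseteq> V" and closed: "\<And>x y. x \<in> C \<Longrightarrow> y \<in> V \<Longrightarrow> w x y > 0 \<Longrightarrow> y \<in> C"
  shows "(\<Sum>x\<in>C. weight x * (lazy_step \<delta> ^^ k) f x) = (\<Sum>x\<in>C. weight x * f x)"
proof (induction k)
  case (Suc k)
  interpret C: finite_network C w
  proof
    show "finite C" using assms(1) finite_V finite_subset by blast
    show "0 < (\<Sum>y\<in>C. w x y)" if "x \<in> C" for x
    proof -
      have "(\<Sum>y\<in>C. w x y) = (\<Sum>y\<in>V. w x y)"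
        using assms that w_nonneg finite_V
        by (intro sum.mono_neutral_left) (auto simp: less_le)
      then show ?thesis using sum_w_pos[of x] assms(1) that by auto
    qed
  qed (rule w_sym w_nonneg)+
  have restrict: "(\<Sum>y\<in>V. w x y * g y) = (\<Sum>y\<in>C. w x y * g y)" if "x \<in> C" for x and g :: "'v \<Rightarrow> real"
    using assms that w_nonneg finite_V
    by (intro sum.mono_neutral_right) (auto simp: less_le)
  have wC: "weight x = C.weight x" if "x \<in> C" for x
    using restrict[OF that, of "\<lambda>_. 1"] by (simp add: weight_def C.weight_def)
  let ?f = "(lazy_step \<delta> ^^ k) f"
  have "(\<Sum>x\<in>C. weight x * lazy_step \<delta> ?f x) = (\<Sum>x\<in>C. \<Sum>y\<in>C. w x y * (\<delta> * ?f x + (1 - \<delta>) * ?f y))"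
    using assms(1) by (intro sum.cong refl) (subst lazy_step_eq_average, auto simp: restrict)
  also have "\<dots> = (\<Sum>x\<in>C. \<Sum>y\<in>C. \<delta> * (w x y * ?f x) + (1 - \<delta>) * (w x y * ?f y))"
    by (simp add: algebra_simps)
  also have "\<dots> = \<delta> * (\<Sum>x\<in>C. \<Sum>y\<in>C. w x y * ?f x) + (1 - \<delta>) * (\<Sum>x\<in>C. \<Sum>y\<in>C. w x y * ?f y)"
    by (simp only: sum_distrib_left sum.distrib)
  also have "(\<Sum>x\<in>C. \<Sum>y\<in>C. w x y * ?f y) = (\<Sum>x\<in>C. weight x * ?f x)"
    using wC by (simp add: C.sum_weight_swap)
  also have "(\<Sum>x\<in>C. \<Sum>y\<in>C. w x y * ?f x) = (\<Sum>x\<in>C. weight x * ?f x)"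
    using wC by (simp add: C.weight_def sum_distrib_right)
  finally show ?case using Suc by (simp add: algebra_simps)
qed simp

text \<open>
  On a component the values of \<open>Q\<^sup>k f\<close> merge while their weighted sum stays constant, so each of
  them tends to the weighted mean.
\<close>
theorem lazy_walk_tendsto_mean:
  assumes "0 < \<delta>" "\<delta> < 1"
    and C: "C \<subseteq> V" "\<And>x y. x \<in> C \<Longrightarrow> y \<in> V \<Longrightarrow> w x y > 0 \<Longrightarrow> y \<in> C"
    and "x \<in> C" and linked: "\<And>y. y \<in> C \<Longrightarrow> (x, y) \<in> links\<^sup>*"
  shows "(\<lambda>k. (lazy_step \<delta> ^^ k) f x) \<longlonglongrightarrow> (\<Sum>y\<in>C. weight y * f y) / (\<Sum>y\<in>C. weight y)"
proof -
  let ?f = "\<lambda>k. (lazy_step \<delta> ^^ k) f" and ?W = "\<Sum>y\<in>C. weight y"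
  have "finite C" using C(1) finite_V finite_subset by blast
  then have W: "?W > 0"
    using C(1) weight_pos \<open>x \<in> C\<close> by (intro sum_pos) auto
  (* Q^k f x differs from the conserved mean by a weighted sum of differences inside C. *)
  have "?f k x * ?W = (\<Sum>y\<in>C. weight y * (?f k x - ?f k y)) + (\<Sum>y\<in>C. weight y * ?f k y)" for k
    by (simp add: sum_distrib_right right_diff_distrib sum_subtractf mult.commute)
  then have eq: "?f k x = ((\<Sum>y\<in>C. weight y * (?f k x - ?f k y)) + (\<Sum>y\<in>C. weight y * f y)) / ?W" for k
    using W weighted_sum_conserved[OF C] by (simp add: field_simps)
  have "(\<lambda>k. ((\<Sum>y\<in>C. weight y * (?f k x - ?f k y)) + (\<Sum>y\<in>C. weight y * f y)) / ?W)
      \<longlonglongrightarrow> ((\<Sum>y\<in>C. weight y * 0) + (\<Sum>y\<in>C. weight y * f y)) / ?W"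
    using W linked by (intro tendsto_intros linked_values_merge assms(1,2)) auto
  then show ?thesis
    unfolding eq[symmetric] by simp
qed

end

section \<open>Degrees and components of finite multigraphs\<close>

lemma adj_sym: "multigraph H \<Longrightarrow> adj H x y = adj H y x"
  by (simp add: multigraph_def)

lemma adj_in_verts: "multigraph H \<Longrightarrow> adj H x y > 0 \<Longrightarrow> x \<in> verts H \<and> y \<in> verts H"
  by (auto simp: multigraph_def)

lemma vertex_degree_eq_sum:
  assumes "multigraph H" "finite (verts H)"
  shows "vertex_degree H x = (\<Sum>y\<in>verts H. adj H x y)"
  unfolding vertex_degree_def
  using assms by (intro sum.mono_neutral_left) (auto dest: adj_in_verts)

lemma sym_edge_rel: "multigraph H \<Longrightarrow> sym (edge_rel H)"
  by (auto simp: sym_def edge_rel_def adj_sym)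

lemma reachable_in_verts:
  assumes "multigraph H" "x \<in> verts H" "(x, y) \<in> (edge_rel H)\<^sup>*"
  shows "y \<in> verts H"
  using assms(3,2) by (induction) (auto simp: edge_rel_def dest: adj_in_verts[OF assms(1)])

lemma verts_component:
  assumes "multigraph H" "x \<in> verts H"
  shows "verts (component H x) = {y. (x, y) \<in> (edge_rel H)\<^sup>*}"
  using reachable_in_verts[OF assms] by (auto simp: component_def induced_def)

lemma verts_component_eq:
  assumes H: "multigraph H" and x: "x \<in> verts H" and y: "y \<in> verts (component H x)"
  shows "verts (component H y) = verts (component H x)"
proof -
  have xy: "(x, y) \<in> (edge_rel H)\<^sup>*" using y verts_component[OF H x] by simp
  then have "(y, x) \<in> (edge_rel H)\<^sup>*"
    using sym_edge_rel[OF H] by (meson sym_rtrancl symD)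
  moreover have "y \<in> verts H" using xy H x reachable_in_verts by blast
  ultimately show ?thesis
    using xy verts_component[OF H] x by (auto intro: rtrancl_trans)
qed

lemma rooted_graph_component:
  assumes H: "multigraph H" and fin: "finite (verts H)" and x: "x \<in> verts H"
  shows "rooted_graph (component H x, x)"
proof -
  let ?C = "component H x"
  have adjC: "adj ?C y z = (if (x, y) \<in> (edge_rel H)\<^sup>* \<and> (x, z) \<in> (edge_rel H)\<^sup>* then adj H y z else 0)" for y z
    by (simp add: component_def induced_def)
  have "multigraph ?C"
    unfolding multigraph_def adjC verts_component[OF H x] using adj_sym[OF H] by auto
  moreover have "locally_finite ?C"
    unfolding locally_finite_def adjC
    using fin by (auto intro!: finite_subset[OF _ fin] dest: adj_in_verts[OF H])
  moreover have fromx: "(x, y) \<in> (edge_rel ?C)\<^sup>*" if "(x, y) \<in> (edge_rel H)\<^sup>*" for y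
    using that
  proof induction
    case (step y z)
    then have "(x, z) \<in> (edge_rel H)\<^sup>*" by simp
    then have "(y, z) \<in> edge_rel ?C" using step by (auto simp: edge_rel_def adjC)
    then show ?case using step by simp
  qed simp
  have "graph_connected ?C"
    unfolding graph_connected_def verts_component[OF H x]
    using fromx sym_rtrancl[OF sym_edge_rel[OF \<open>multigraph ?C\<close>]]
    by (blast dest: symD intro: rtrancl_trans)
  ultimately show ?thesis
    by (auto simp: rooted_graph_def verts_component[OF H x])
qed

lemma root_degree_component_at:
  assumes H: "multigraph H" and fin: "finite (verts H)" and x: "x \<in> verts H"
  shows "root_degree (component_at H x) = vertex_degree H x"
proof -
  have "rooted_equiv (component H x, x) (component H x, x)"
    using rooted_graph_component[OF assms] rooted_iso_refl by (simp add: rooted_equiv_def)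
  then have "root_degree (component_at H x) = vertex_degree (component H x) x"
    unfolding component_at_def by (simp add: root_degree.abs_eq)
  also have "\<dots> = vertex_degree H x"
  proof -
    have "adj (component H x) x y = adj H x y" for y
      by (auto simp: component_def induced_def edge_rel_def)
    then show ?thesis by (simp add: vertex_degree_def)
  qed
  finally show ?thesis .
qed

section \<open>Lazy exploration of a fixed graph\<close>

lemma finite_network_multigraph:
  assumes "multigraph H" "finite (verts H)" "no_isolated_vertices H"
  shows "finite_network (verts H) (\<lambda>x y. real (adj H x y))"
proof
  fix x assume "x \<in> verts H"
  then have "vertex_degree H x > 0" using assms by (simp add: no_isolated_vertices_def)
  then show "0 < (\<Sum>y\<in>verts H. real (adj H x y))"
    using assms by (simp add: vertex_degree_eq_sum flip: of_nat_sum)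
qed (use assms in \<open>auto simp: adj_sym\<close>)

lemma sum_atLeast1_shift: "(\<Sum>j\<in>{1..n}. g j) = (\<Sum>j<n. g (Suc j))"
  by (rule sum.reindex_bij_witness[of _ Suc "\<lambda>j. j - 1"]) auto

text \<open>
  Powers of the lazy transition matrix act on functions as iterated lazy steps; the shift by one is
  the passage from vertices to matrix indices.
\<close>
lemma lazy_matrix_eq_funpow:
  assumes H: "multigraph H" "verts H = {1..n}" "no_isolated_vertices H" and i: "i \<in> {1..n}"
  shows "(\<Sum>j\<in>{1..n}. lazy_matrix \<delta> n k H $$ (i - 1, j - 1) * f j) =
    (finite_network.lazy_step (verts H) (\<lambda>x y. real (adj H x y)) \<delta> ^^ k) f i"
proof -
  interpret finite_network "verts H" "\<lambda>x y. real (adj H x y)"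
    using H by (intro finite_network_multigraph) auto
  let ?Q = "\<delta> \<cdot>\<^sub>m 1\<^sub>m n + (1 - \<delta>) \<cdot>\<^sub>m transition_matrix n H"
  have Q: "?Q \<in> carrier_mat n n" by (simp add: transition_matrix_def)
  have deg: "weight x = vertex_degree H x" for x
    using H unfolding weight_def by (subst vertex_degree_eq_sum) auto
  have step: "lazy_step \<delta> g x =
      \<delta> * g x + (1 - \<delta>) * ((\<Sum>y\<in>{1..n}. real (adj H x y) * g y) / vertex_degree H x)" for g x
    by (simp only: lazy_step_def deg H(2)[symmetric])
  have one: "(\<Sum>j<n. ?Q $$ (l, j) * g (Suc j)) = lazy_step \<delta> g (Suc l)" if l: "l < n" for l g
  proof -
    have "(\<Sum>j<n. ?Q $$ (l, j) * g (Suc j)) = (\<Sum>j<n. (if l = j then \<delta> * g (Suc j) else 0)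
        + (1 - \<delta>) * (real (adj H (Suc l) (Suc j)) * g (Suc j) / vertex_degree H (Suc l)))"
      using l by (intro sum.cong) (auto simp: transition_matrix_def algebra_simps)
    also have "\<dots> = lazy_step \<delta> g (Suc l)"
      using l by (simp add: step sum_atLeast1_shift sum.distrib sum_distrib_left sum_divide_distrib
          del: One_nat_def)
    finally show ?thesis .
  qed
  (* The power recursion appends a factor on the right, so g changes to its image under one step. *)
  have "(\<Sum>j<n. (?Q ^\<^sub>m k) $$ (l, j) * g (Suc j)) = (lazy_step \<delta> ^^ k) g (Suc l)" if "l < n" for l g
  proof (induction k arbitrary: g)
    case 0
    have "(\<Sum>j<n. (?Q ^\<^sub>m 0) $$ (l, j) * g (Suc j)) = (\<Sum>j<n. if l = j then g (Suc j) else 0)"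
      using that Q by (intro sum.cong) auto
    then show ?case using that by simp
  next
    case (Suc k)
    have Qk: "?Q ^\<^sub>m k \<in> carrier_mat n n" using Q by simp
    have "(\<Sum>j<n. (?Q ^\<^sub>m Suc k) $$ (l, j) * g (Suc j)) =
        (\<Sum>j<n. \<Sum>m<n. (?Q ^\<^sub>m k) $$ (l, m) * (?Q $$ (m, j) * g (Suc j)))"
    proof (intro sum.cong refl)
      fix j assume "j \<in> {..<n}"
      then have "(?Q ^\<^sub>m Suc k) $$ (l, j) = (\<Sum>m<n. (?Q ^\<^sub>m k) $$ (l, m) * ?Q $$ (m, j))"
        using that Q Qk
        by (auto simp: scalar_prod_def atLeast0LessThan index_mult_mat(1) simp del: index_add_mat
            intro!: sum.cong)
      then show "(?Q ^\<^sub>m Suc k) $$ (l, j) * g (Suc j) = (\<Sum>m<n. (?Q ^\<^sub>m k) $$ (l, m) * (?Q $$ (m, j) * g (Suc j)))"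
        by (simp only: sum_distrib_right mult.assoc)
    qed
    also have "\<dots> = (\<Sum>m<n. (?Q ^\<^sub>m k) $$ (l, m) * (\<Sum>j<n. ?Q $$ (m, j) * g (Suc j)))"
      by (subst sum.swap) (simp only: sum_distrib_left)
    also have "\<dots> = (\<Sum>m<n. (?Q ^\<^sub>m k) $$ (l, m) * lazy_step \<delta> g (Suc m))"
      by (intro sum.cong refl) (simp only: one lessThan_iff)
    also have "\<dots> = (lazy_step \<delta> ^^ Suc k) g (Suc l)"
      by (simp only: Suc.IH funpow_Suc_right comp_apply)
    finally show ?case .
  qed
  from this[of "i - 1" f] i show ?thesis
    by (simp only: lazy_matrix_def sum_atLeast1_shift) auto
qed

text \<open>
  On the component of \<open>i\<close> all the denominators in \<open>pi_c\<close> agree, so that the stationary mean of the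
  degree is exactly the limit provided by the walk.
\<close>
theorem Delta_lazy_tendsto:
  assumes H: "multigraph H" "verts H = {1..n}" "no_isolated_vertices H"
    and \<delta>: "0 < \<delta>" "\<delta> < 1" and i: "i \<in> {1..n}"
  shows "(\<lambda>k. Delta_lazy \<delta> n k H i) \<longlonglongrightarrow> Delta_st H i"
proof -
  interpret finite_network "verts H" "\<lambda>x y. real (adj H x y)"
    using H by (intro finite_network_multigraph) auto
  let ?C = "verts (component H i)"
  have iH: "i \<in> verts H" using i H by simp
  note C = verts_component[OF H(1) iH]
  have links: "links = edge_rel H"
    using adj_in_verts[OF H(1)] by (auto simp: links_def edge_rel_def)
  have deg: "weight x = vertex_degree H x" for x
    using H unfolding weight_def by (subst vertex_degree_eq_sum) auto
  have "(\<lambda>k. (lazy_step \<delta> ^^ k) (\<lambda>j. real (vertex_degree H j)) i) \<longlonglongrightarrow>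
      (\<Sum>y\<in>?C. weight y * vertex_degree H y) / (\<Sum>y\<in>?C. weight y)"
  proof (rule lazy_walk_tendsto_mean[OF \<delta>])
    show "?C \<subseteq> verts H" using reachable_in_verts[OF H(1) iH] C by auto
    show "y \<in> ?C" if "x \<in> ?C" "real (adj H x y) > 0" for x y
      using that unfolding C by (auto simp: edge_rel_def intro: rtrancl_into_rtrancl)
  qed (auto simp: C links)
  moreover have "(\<Sum>j\<in>?C. pi_c H j * vertex_degree H j) =
      (\<Sum>y\<in>?C. weight y * vertex_degree H y) / (\<Sum>y\<in>?C. weight y)"
    by (simp add: pi_c_def verts_component_eq[OF H(1) iH] deg sum_divide_distrib)
  ultimately show ?thesis
    unfolding Delta_lazy_def Delta_st_def lazy_matrix_eq_funpow[OF H i]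
    by (auto intro!: tendsto_intros)
qed

section \<open>Empirical measures\<close>

lemma measurable_uniform_count: "a \<in> measurable (uniform_count_measure A) borel"
  by (auto simp: measurable_def space_uniform_count_measure sets_uniform_count_measure)

lemma integral_empirical_measure:
  assumes "f \<in> borel_measurable borel"
  shows "(\<integral>x. f x \<partial>empirical_measure n a) = (\<Sum>i\<in>{1..n}. f (a i)) / real n"
  unfolding empirical_measure_def
  by (subst integral_distr[OF measurable_uniform_count assms])
     (simp add: integral_uniform_count_measure)

lemma weak_conv_empirical_measure:
  assumes "n \<ge> 1" and lim: "\<And>i. i \<in> {1..n} \<Longrightarrow> (\<lambda>k. a k i) \<longlonglongrightarrow> b i"
  shows "weak_conv_m (\<lambda>k. empirical_measure n (a k)) (empirical_measure n b)"
proof -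
  have rd: "real_distribution (empirical_measure n c)" for c
    unfolding empirical_measure_def
    by (intro prob_space.real_distribution_distr prob_space_uniform_count_measure measurable_uniform_count)
       (use \<open>n \<ge> 1\<close> in auto)
  show ?thesis
  proof (rule integral_bdd_continuous_conv_imp_weak_conv[OF rd rd])
    fix f :: "real \<Rightarrow> real" assume f: "\<And>x. isCont f x"
    then have [measurable]: "f \<in> borel_measurable borel"
      by (intro borel_measurable_continuous_onI continuous_at_imp_continuous_on) simp
    show "(\<lambda>k. \<integral>x. f x \<partial>empirical_measure n (a k)) \<longlonglongrightarrow> (\<integral>x. f x \<partial>empirical_measure n b)"
      using \<open>n \<ge> 1\<close> by (simp add: integral_empirical_measure)
        (intro tendsto_intros isCont_tendsto_compose[OF f] lim, auto)
  qed
qed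

section \<open>Random graphs\<close>

text \<open>
  A multigraph on a finite vertex set is determined by a list of finitely many natural numbers.  Such
  lists form a countable type, on which every function is measurable; hence every functional
  of a random multigraph is a random variable and every property of it an event.
\<close>
lemma measurable_random_multigraph:
  assumes G: "random_multigraph M V G" and fin: "finite V" and F: "\<And>H. F H \<in> space N"
  shows "(\<lambda>\<omega>. F (G \<omega>)) \<in> measurable M N"
proof -
  obtain ps where ps: "set ps = V \<times> V"
    using finite_list[of "V \<times> V"] fin by auto
  define code where "code \<omega> = map (\<lambda>(x, y). adj (G \<omega>) x y) ps" for \<omega>
  have [measurable]: "(\<lambda>\<omega>. adj (G \<omega>) x y) \<in> measurable M (count_space UNIV)" for x y
    using G by (simp add: random_multigraph_def)
  have code: "code \<in> measurable M (count_space UNIV)"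
  proof (subst measurable_count_space_eq2_countable, safe)
    fix l
    have "code -` {l} \<inter> space M = (if length l = length ps then
        {\<omega> \<in> space M. \<forall>i\<in>{..<length ps}. adj (G \<omega>) (fst (ps ! i)) (snd (ps ! i)) = l ! i} else {})"
      by (auto simp: code_def list_eq_iff_nth_eq split_beta)
    also have "\<dots> \<in> sets M" by simp
    finally show "code -` {l} \<inter> space M \<in> sets M" .
  qed auto
  have decode: "G \<omega> = G \<omega>'" if "code \<omega> = code \<omega>'" "\<omega> \<in> space M" "\<omega>' \<in> space M" for \<omega> \<omega>'
  proof (rule mgraph.expand, intro conjI ext)
    have H: "multigraph (G \<omega>)" "multigraph (G \<omega>')" "verts (G \<omega>) = V" "verts (G \<omega>') = V"
      using G that by (auto simp: random_multigraph_def)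
    then show "verts (G \<omega>) = verts (G \<omega>')" by simp
    fix x y
    show "adj (G \<omega>) x y = adj (G \<omega>') x y"
    proof (cases "(x, y) \<in> V \<times> V")
      case True
      then show ?thesis using that(1) ps by (auto simp: code_def)
    next
      case False
      then have "\<not> adj (G \<omega>) x y > 0" "\<not> adj (G \<omega>') x y > 0"
        using adj_in_verts[OF H(1), of x y] adj_in_verts[OF H(2), of x y] H(3,4) by blast+
      then show ?thesis by simp
    qed
  qed
  (* D inverts the encoding on its range. *)
  define D where "D l = G (SOME \<omega>. \<omega> \<in> space M \<and> code \<omega> = l)" for l
  have "D (code \<omega>) = G \<omega>" if "\<omega> \<in> space M" for \<omega>
    unfolding D_def using that
    by (intro decode) (metis (mono_tags, lifting) someI_ex)+
  then have "(\<lambda>\<omega>. F (D (code \<omega>))) \<in> measurable M N \<longleftrightarrow> (\<lambda>\<omega>. F (G \<omega>)) \<in> measurable M N"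
    by (intro measurable_cong) simp
  moreover have "(\<lambda>\<omega>. F (D (code \<omega>))) \<in> measurable M N"
    by (rule measurable_compose[OF code]) (simp add: F)
  ultimately show ?thesis by simp
qed

definition degree_avg :: "nat \<Rightarrow> (nat \<Rightarrow> real) \<Rightarrow> mgraph \<Rightarrow> real" where
  "degree_avg n \<phi> H = (\<Sum>i\<in>{1..n}. \<phi> (vertex_degree H i)) / real n"

lemma degree_avg_mono: "(\<And>d. \<phi> d \<le> \<psi> d) \<Longrightarrow> degree_avg n \<phi> H \<le> degree_avg n \<psi> H"
  by (auto simp: degree_avg_def intro!: divide_right_mono sum_mono)

lemma degree_avg_diff: "degree_avg n \<phi> H - degree_avg n \<psi> H = degree_avg n (\<lambda>d. \<phi> d - \<psi> d) H"
  by (simp add: degree_avg_def sum_subtractf diff_divide_distrib)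

lemma degree_avg_const_add: "n \<ge> 1 \<Longrightarrow> degree_avg n (\<lambda>d. b + \<phi> d) H = b + degree_avg n \<phi> H"
  by (simp add: degree_avg_def sum.distrib add_divide_distrib)

lemma degree_avg_scale: "degree_avg n (\<lambda>d. b * \<phi> d) H = b * degree_avg n \<phi> H"
  by (simp add: degree_avg_def sum_distrib_left)

lemma abs_degree_avg_le: "\<bar>degree_avg n \<phi> H\<bar> \<le> degree_avg n (\<lambda>d. \<bar>\<phi> d\<bar>) H"
  by (simp add: degree_avg_def abs_divide divide_right_mono sum_abs)

lemma degree_avg_close:
  assumes "\<And>d. \<bar>\<phi> d - \<psi> d\<bar> \<le> \<tau> d"
  shows "\<bar>degree_avg n \<phi> H - degree_avg n \<psi> H\<bar> \<le> degree_avg n \<tau> H"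
  unfolding degree_avg_diff by (rule order_trans[OF abs_degree_avg_le degree_avg_mono]) (rule assms)

locale random_graph_sequence =
  fixes M :: "nat \<Rightarrow> 'a measure" and G :: "nat \<Rightarrow> 'a \<Rightarrow> mgraph"
  assumes random_graph: "\<And>n. n \<ge> 2 \<Longrightarrow> random_multigraph (M n) {1..n} (G n)"
begin

lemma measurable_G: "n \<ge> 2 \<Longrightarrow> (\<And>H. F H \<in> space N) \<Longrightarrow> (\<lambda>\<omega>. F (G n \<omega>)) \<in> measurable (M n) N"
  using measurable_random_multigraph[OF random_graph] by blast

lemma sets_G: "n \<ge> 2 \<Longrightarrow> {\<omega> \<in> space (M n). P (G n \<omega>)} \<in> sets (M n)"
  using measurable_G[of n P "count_space UNIV"] by (simp add: pred_def)

lemma multigraph_G: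
  "n \<ge> 2 \<Longrightarrow> \<omega> \<in> space (M n) \<Longrightarrow> multigraph (G n \<omega>) \<and> verts (G n \<omega>) = {1..n}"
  using random_graph by (auto simp: random_multigraph_def)

lemma prob_space_M: "n \<ge> 2 \<Longrightarrow> prob_space (M n)"
  using random_graph by (simp add: random_multigraph_def)

definition fail_prob :: "(nat \<Rightarrow> mgraph \<Rightarrow> bool) \<Rightarrow> nat \<Rightarrow> real" where
  "fail_prob P n = measure (M n) {\<omega> \<in> space (M n). \<not> P n (G n \<omega>)}"

text \<open>
  Properties \<open>P n\<close> that hold for \<open>G n\<close> with high probability behave like a filter, which replaces
  explicit estimates of probabilities by implications between properties.
\<close>
definition whp :: "(nat \<Rightarrow> mgraph \<Rightarrow> bool) \<Rightarrow> bool" where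
  "whp P \<longleftrightarrow> fail_prob P \<longlonglongrightarrow> 0"

lemma fail_prob_le:
  assumes "n \<ge> 2"
    and "\<And>\<omega>. \<omega> \<in> space (M n) \<Longrightarrow> P n (G n \<omega>) \<Longrightarrow> Q n (G n \<omega>) \<Longrightarrow> R n (G n \<omega>)"
  shows "fail_prob R n \<le> fail_prob P n + fail_prob Q n"
proof -
  interpret prob_space "M n" using assms prob_space_M by blast
  let ?B = "\<lambda>P. {\<omega> \<in> space (M n). \<not> P n (G n \<omega>)}"
  have "measure (M n) (?B R) \<le> measure (M n) (?B P \<union> ?B Q)"
    using assms sets_G[of n] by (intro finite_measure_mono) auto
  also have "\<dots> \<le> measure (M n) (?B P) + measure (M n) (?B Q)"
    using assms sets_G[of n] by (intro measure_Un_le) auto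
  finally show ?thesis by (simp add: fail_prob_def)
qed

text \<open>
  The second property \<open>Q\<close> need not become certain in the limit: it suffices that it can be chosen
  with a failure probability below any given level.  Uniform integrability only provides such
  properties, through Markov's inequality.
\<close>
lemma whp_approx:
  assumes "\<And>\<eta>. \<eta> > 0 \<Longrightarrow> \<exists>P Q. whp P \<and> (\<forall>n\<ge>2. fail_prob Q n \<le> \<eta>) \<and>
    (\<forall>n\<ge>2. \<forall>\<omega>\<in>space (M n). P n (G n \<omega>) \<longrightarrow> Q n (G n \<omega>) \<longrightarrow> R n (G n \<omega>))"
  shows "whp R"
  unfolding whp_def
proof (rule LIMSEQ_I)
  fix r :: real assume "0 < r"
  then obtain P Q where PQ: "whp P" "\<forall>n\<ge>2. fail_prob Q n \<le> r / 2"
    "\<forall>n\<ge>2. \<forall>\<omega>\<in>space (M n). P n (G n \<omega>) \<longrightarrow> Q n (G n \<omega>) \<longrightarrow> R n (G n \<omega>)"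
    using assms[of "r / 2"] by auto
  obtain N where N: "\<And>n. n \<ge> N \<Longrightarrow> fail_prob P n < r / 2"
    using order_tendstoD(2)[OF PQ(1)[unfolded whp_def], of "r / 2"] \<open>0 < r\<close>
    by (auto simp: eventually_sequentially)
  have "norm (fail_prob R n - 0) < r" if "n \<ge> max N 2" for n
  proof -
    have "fail_prob R n \<le> fail_prob P n + fail_prob Q n"
      using that PQ(3) by (intro fail_prob_le) auto
    moreover have "fail_prob P n < r / 2" "fail_prob Q n \<le> r / 2"
      using N PQ(2) that by auto
    moreover have "0 \<le> fail_prob R n" by (simp add: fail_prob_def)
    ultimately show ?thesis by simp
  qed
  then show "\<exists>no. \<forall>n\<ge>no. norm (fail_prob R n - 0) < r" by blast
qed

lemma whp_combine:
  assumes "whp P" "whp Q"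
    and "\<And>n \<omega>. n \<ge> 2 \<Longrightarrow> \<omega> \<in> space (M n) \<Longrightarrow> P n (G n \<omega>) \<Longrightarrow> Q n (G n \<omega>) \<Longrightarrow> R n (G n \<omega>)"
  shows "whp R"
proof -
  have "(\<lambda>n. fail_prob P n + fail_prob Q n) \<longlonglongrightarrow> 0"
    using tendsto_add[of "fail_prob P" 0 sequentially "fail_prob Q" 0] assms(1,2) by (simp add: whp_def)
  then show ?thesis
    unfolding whp_def
  proof (rule tendsto_sandwich[OF _ _ tendsto_const, rotated 2])
    show "\<forall>\<^sub>F n in sequentially. fail_prob R n \<le> fail_prob P n + fail_prob Q n"
      using fail_prob_le[of _ P Q R] assms(3) by (auto intro!: eventually_sequentiallyI[of 2])
  qed (simp add: fail_prob_def)
qed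

text \<open>
  Existence by the probabilistic method; it turns estimates for random averages into estimates for
  the constants that they converge to.
\<close>
lemma whp_realised:
  assumes "whp P" "\<And>n. n \<ge> 2 \<Longrightarrow> fail_prob Q n \<le> \<eta>" "\<eta> < 1"
  shows "\<exists>n\<ge>2. \<exists>\<omega>\<in>space (M n). P n (G n \<omega>) \<and> Q n (G n \<omega>)"
proof (rule ccontr)
  assume none: "\<not> ?thesis"
  have "1 - \<eta> \<le> fail_prob P n" if "n \<ge> 2" for n
  proof -
    interpret prob_space "M n" using that prob_space_M by blast
    have "fail_prob (\<lambda>_ _. False) n \<le> fail_prob P n + fail_prob Q n"
      using none that by (intro fail_prob_le) auto
    moreover have "fail_prob (\<lambda>_ _. False) n = 1" by (simp add: fail_prob_def prob_space)
    ultimately show ?thesis using assms(2)[OF that] by simp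
  qed
  then have "1 - \<eta> \<le> 0"
    using assms(1) by (intro LIMSEQ_le_const[of "fail_prob P" 0]) (auto simp: whp_def)
  then show False using assms(3) by simp
qed

text \<open>
  Convergence in probability for functionals of the graph, which have the measurability
  needed to work with high-probability events.
\<close>
definition conv :: "(nat \<Rightarrow> mgraph \<Rightarrow> real) \<Rightarrow> real \<Rightarrow> bool" where
  "conv X c \<longleftrightarrow> conv_in_prob M (\<lambda>n \<omega>. X n (G n \<omega>)) c"

lemma conv_iff_whp: "conv X c \<longleftrightarrow> (\<forall>\<epsilon>>0. whp (\<lambda>n H. \<bar>X n H - c\<bar> \<le> \<epsilon>))"
  by (simp add: conv_def conv_in_prob_def whp_def fail_prob_def[abs_def] not_le)

lemma conv_whp: "conv X c \<Longrightarrow> \<epsilon> > 0 \<Longrightarrow> whp (\<lambda>n H. \<bar>X n H - c\<bar> \<le> \<epsilon>)"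
  by (simp add: conv_iff_whp)

lemma conv_continuous2:
  assumes "conv X a" "conv Y b" and g: "isCont (\<lambda>p. g (fst p) (snd p)) (a, b)"
  shows "conv (\<lambda>n H. g (X n H) (Y n H)) (g a b)"
  unfolding conv_iff_whp
proof (intro allI impI)
  fix \<epsilon> :: real assume "\<epsilon> > 0"
  then obtain r where r: "r > 0" "\<And>p. dist p (a, b) < r \<Longrightarrow> dist (g (fst p) (snd p)) (g a b) < \<epsilon>"
    using g unfolding continuous_at_eps_delta by fastforce
  have "\<bar>g x y - g a b\<bar> \<le> \<epsilon>" if "\<bar>x - a\<bar> \<le> r / 3" "\<bar>y - b\<bar> \<le> r / 3" for x y
  proof -
    have "dist (x, y) (a, b) \<le> \<bar>x - a\<bar> + \<bar>y - b\<bar>"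
      unfolding dist_Pair_Pair dist_real_def by (rule sqrt_sum_squares_le_sum_abs[THEN order_trans]) simp
    then show ?thesis using r that r(2)[of "(x, y)"] by (auto simp: dist_real_def)
  qed
  moreover have "r / 3 > 0" using r(1) by simp
  ultimately show "whp (\<lambda>n H. \<bar>g (X n H) (Y n H) - g a b\<bar> \<le> \<epsilon>)"
    by (intro whp_combine[OF conv_whp[OF assms(1)] conv_whp[OF assms(2)]])
qed

text \<open>
  Averaging over \<open>i\<close> the bound on the tail of \<open>d\<^sub>i\<^sup>2\<close> from uniform integrability bounds the
  expectation of the averaged tail, and Markov's inequality does the rest.
\<close>
lemma uniform_tail:
  assumes UI: "uniformly_integrable (SIGMA n:{2..}. {1..n}) (\<lambda>(n, i). M n)
      (\<lambda>(n, i) \<omega>. (real (vertex_degree (G n \<omega>) i))\<^sup>2)"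
    and "\<epsilon> > 0" "\<eta> > 0"
  shows "\<exists>K. \<forall>n\<ge>2.
    fail_prob (\<lambda>n H. degree_avg n (\<lambda>d. if d > K then (real d)\<^sup>2 else 0) H \<le> \<epsilon>) n \<le> \<eta>"
proof -
  define T where "T n i t = (\<integral>\<^sup>+\<omega>. ennreal ((real (vertex_degree (G n \<omega>) i))\<^sup>2) *
      indicator {\<omega>. (real (vertex_degree (G n \<omega>) i))\<^sup>2 > t} \<omega> \<partial>M n)" for n i and t :: real
  have "((\<lambda>t. SUP (n, i)\<in>(SIGMA n:{2..}. {1..n}). T n i t) \<longlongrightarrow> 0) at_top"
    using UI by (simp add: uniformly_integrable_def T_def split_beta)
  then have "eventually (\<lambda>t. (SUP (n, i)\<in>(SIGMA n:{2..}. {1..n}). T n i t) < ennreal (\<epsilon> * \<eta>)) at_top"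
    using assms(2,3) by (intro order_tendstoD) auto
  then obtain t0 where t0: "\<And>t. t \<ge> t0 \<Longrightarrow> (SUP (n, i)\<in>(SIGMA n:{2..}. {1..n}). T n i t) < ennreal (\<epsilon> * \<eta>)"
    by (auto simp: eventually_at_top_linorder)
  obtain K :: nat where K: "K \<ge> 1" "real K \<ge> t0"
    by (metis real_arch_simple linorder_le_cases of_nat_mono order_trans)
  (* The threshold for squares is K^2, so that it corresponds to the degree threshold K. *)
  have "real K \<le> (real K)\<^sup>2" using K(1) by (simp add: power2_eq_square)
  then have SUPK: "(SUP (n, i)\<in>(SIGMA n:{2..}. {1..n}). T n i ((real K)\<^sup>2)) < ennreal (\<epsilon> * \<eta>)"
    by (intro t0) (use K(2) in linarith)
  have TK: "T n i ((real K)\<^sup>2) \<le> ennreal (\<epsilon> * \<eta>)" if "n \<ge> 2" "i \<in> {1..n}" for n i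
  proof -
    have "T n i ((real K)\<^sup>2) \<le> (SUP (n, i)\<in>(SIGMA n:{2..}. {1..n}). T n i ((real K)\<^sup>2))"
      using that by (intro SUP_upper2[of "(n, i)"]) auto
    then show ?thesis using SUPK by simp
  qed
  have "fail_prob (\<lambda>n H. degree_avg n (\<lambda>d. if d > K then (real d)\<^sup>2 else 0) H \<le> \<epsilon>) n \<le> \<eta>"
    if n: "n \<ge> 2" for n
  proof -
    interpret prob_space "M n" using n prob_space_M by blast
    let ?X = "\<lambda>\<omega>. degree_avg n (\<lambda>d. if d > K then (real d)\<^sup>2 else 0) (G n \<omega>)"
    let ?t = "\<lambda>i \<omega>. ennreal ((real (vertex_degree (G n \<omega>) i))\<^sup>2) *
      indicator {\<omega>. (real (vertex_degree (G n \<omega>) i))\<^sup>2 > (real K)\<^sup>2} \<omega>"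
    have [measurable]: "?t i \<in> borel_measurable (M n)" for i
      using measurable_G[OF n, of "\<lambda>H. ennreal ((real (vertex_degree H i))\<^sup>2) *
        indicator {H. (real (vertex_degree H i))\<^sup>2 > (real K)\<^sup>2} H" borel]
      by (simp add: indicator_def)
    have sq: "(real d)\<^sup>2 > (real K)\<^sup>2 \<longleftrightarrow> d > K" for d
      by (simp flip: not_le add: power_mono_iff)
    have X: "ennreal (?X \<omega>) = ennreal (1 / real n) * (\<Sum>i\<in>{1..n}. ?t i \<omega>)" for \<omega>
    proof -
      have "(\<Sum>i\<in>{1..n}. ?t i \<omega>) = (\<Sum>i\<in>{1..n}. ennreal
          (if vertex_degree (G n \<omega>) i > K then (real (vertex_degree (G n \<omega>) i))\<^sup>2 else 0))"
        by (intro sum.cong refl) (simp add: indicator_def sq)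
      also have "\<dots> = ennreal (\<Sum>i\<in>{1..n}. 
          (if vertex_degree (G n \<omega>) i > K then (real (vertex_degree (G n \<omega>) i))\<^sup>2 else 0))"
        by (intro sum_ennreal) auto
      finally show ?thesis
        by (simp add: degree_avg_def ennreal_mult[symmetric] sum_nonneg)
    qed
    have [measurable]: "?X \<in> borel_measurable (M n)" by (rule measurable_G[OF n]) simp
    have "(\<integral>\<^sup>+\<omega>. ennreal (?X \<omega>) \<partial>M n) = ennreal (1 / real n) * (\<Sum>i\<in>{1..n}. T n i ((real K)\<^sup>2))"
    proof -
      have "(\<Sum>i\<in>{1..n}. T n i ((real K)\<^sup>2)) = (\<integral>\<^sup>+\<omega>. (\<Sum>i\<in>{1..n}. ?t i \<omega>) \<partial>M n)"
        unfolding T_def by (rule nn_integral_sum[symmetric]) measurable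
      then show ?thesis
        unfolding X by (simp only:) (rule nn_integral_cmult, measurable)
    qed
    also have "\<dots> \<le> ennreal (1 / real n) * (\<Sum>i\<in>{1..n}. ennreal (\<epsilon> * \<eta>))"
      using TK n by (intro mult_left_mono sum_mono) auto
    also have "\<dots> = ennreal (\<epsilon> * \<eta>)"
      using n assms(2,3) by (simp add: ennreal_of_nat_eq_real_of_nat ennreal_mult[symmetric])
    finally have int: "(\<integral>\<^sup>+\<omega>. ennreal (?X \<omega>) \<partial>M n) \<le> ennreal (\<epsilon> * \<eta>)" .
    have "emeasure (M n) {\<omega>\<in>space (M n). \<not> ?X \<omega> \<le> \<epsilon>} \<le>
        emeasure (M n) {\<omega>\<in>space (M n). 1 \<le> ennreal (1 / \<epsilon>) * ennreal (?X \<omega>)}"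
    proof (intro emeasure_mono subsetI)
      fix \<omega> assume "\<omega> \<in> {\<omega>\<in>space (M n). \<not> ?X \<omega> \<le> \<epsilon>}"
      then have "\<omega> \<in> space (M n)" "1 \<le> 1 / \<epsilon> * ?X \<omega>" using assms(2) by (auto simp: field_simps)
      then show "\<omega> \<in> {\<omega>\<in>space (M n). 1 \<le> ennreal (1 / \<epsilon>) * ennreal (?X \<omega>)}"
        using assms(2) ennreal_leI[of 1 "1 / \<epsilon> * ?X \<omega>"] by (simp add: ennreal_mult'[symmetric])
    qed simp
    also have "\<dots> \<le> ennreal (1 / \<epsilon>) * (\<integral>\<^sup>+\<omega>. ennreal (?X \<omega>) * indicator (space (M n)) \<omega> \<partial>M n)"
      by (rule nn_integral_Markov_inequality) auto
    also have "\<dots> = ennreal (1 / \<epsilon>) * (\<integral>\<^sup>+\<omega>. ennreal (?X \<omega>) \<partial>M n)"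
      by (intro arg_cong2[where f = "(*)"] nn_integral_cong refl) simp
    also have "\<dots> \<le> ennreal (1 / \<epsilon>) * ennreal (\<epsilon> * \<eta>)"
      using int by (rule mult_left_mono) simp
    also have "\<dots> = ennreal \<eta>" using assms(2,3) by (simp add: ennreal_mult[symmetric])
    finally show ?thesis
      using assms(3) unfolding fail_prob_def by (simp add: emeasure_eq_measure)
  qed
  then show ?thesis by blast
qed

end

section \<open>The root degree on the space of rooted graphs\<close>

lemma vertex_degree_graph_ball:
  assumes "multigraph H" "x \<in> verts H"
  shows "vertex_degree (graph_ball H x 1) x = vertex_degree H x"
proof -
  have "adj (graph_ball H x 1) x y = adj H x y" for y
  proof (cases "adj H x y > 0")
    case True
    then have "(x, y) \<in> edge_rel H ^^ 1" by (simp add: edge_rel_def)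
    then have "y \<in> verts (graph_ball H x 1)"
      unfolding verts_ball[OF assms] by (intro CollectI exI[of _ 1]) auto
    then show ?thesis using adj_ball root_in_ball[OF assms(2)] by blast
  next
    case False
    then show ?thesis by (auto simp: graph_ball_def induced_def)
  qed
  then show ?thesis by (simp add: vertex_degree_def)
qed

lemma multigraph_graph_ball: "multigraph H \<Longrightarrow> multigraph (graph_ball H x r)"
  by (auto simp: multigraph_def graph_ball_def induced_def)

text \<open>
  The balls of radius \<open>1\<close> of two rooted graphs at distance less than \<open>1\<close> are isomorphic, since
  otherwise at most the radius \<open>0\<close> would agree and the distance would be exactly \<open>1\<close>; these balls
  determine the root degree.
\<close>
lemma root_degree_locally_constant: "dist x y < 1 \<Longrightarrow> root_degree x = root_degree y"
proof transfer
  fix p q assume "rooted_equiv p p" "rooted_equiv q q" and d: "rooted_dist p q < 1"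
  then have rg: "rooted_graph p" "rooted_graph q" by (auto simp: rooted_equiv_def)
  obtain H x H' x' where pq: "p = (H, x)" "q = (H', x')" by (cases p, cases q) auto
  have "1 \<in> agree_radii p q"
  proof (rule ccontr)
    assume "1 \<notin> agree_radii p q"
    then have "s = 0" if "s \<in> agree_radii p q" for s
      using agree_radii_downward[OF rg that, of 1] by (cases s) auto
    then have "(SUP r\<in>agree_radii p q. ennreal (real r)) \<le> 0"
      by (intro SUP_least) auto
    then have "rooted_dist p q = 1" by (simp add: rooted_dist_def divide_ennreal_def)
    then show False using d by simp
  qed
  then obtain f where "rooted_map f (graph_ball H x 1, x) (graph_ball H' x' 1, x')"
    by (auto simp: agree_radii_def rooted_iso_def rooted_ball_def pq)
  then have "vertex_degree (graph_ball H' x' 1) x' = vertex_degree (graph_ball H x 1) x"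
    using rg by (intro rooted_map_degree)
      (auto simp: pq rooted_graph_def multigraph_graph_ball root_in_ball)
  then show "(case p of (H, x) \<Rightarrow> vertex_degree H x) = (case q of (H, x) \<Rightarrow> vertex_degree H x)"
    using rg by (simp add: pq rooted_graph_def vertex_degree_graph_ball del: One_nat_def)
qed

lemma continuous_on_root_degree: "continuous_on UNIV (\<lambda>x. (\<phi> :: nat \<Rightarrow> real) (root_degree x))"
  unfolding continuous_on_iff
proof (intro ballI allI impI exI[of _ 1] conjI)
  fix x y :: rgraph and \<epsilon> :: real assume "\<epsilon> > 0" "dist y x < 1"
  then show "dist (\<phi> (root_degree y)) (\<phi> (root_degree x)) < \<epsilon>"
    by (simp add: root_degree_locally_constant[of y x])
qed simp

lemma root_degree_pos: "is_nontrivial_tree x \<Longrightarrow> 1 \<le> root_degree x"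
proof transfer
  fix p assume p: "rooted_equiv p p" "nontrivial_rooted_tree p"
  obtain H x where px: "p = (H, x)" by (cases p)
  have H: "multigraph H" "locally_finite H" "graph_connected H" "x \<in> verts H"
    using p(1) by (auto simp: rooted_equiv_def rooted_graph_def px)
  obtain y where "y \<in> verts H" "y \<noteq> x" using p(2) by (auto simp: nontrivial_rooted_tree_def px)
  then have "(x, y) \<in> (edge_rel H)\<^sup>*" using H by (auto simp: graph_connected_def)
  then obtain z where z: "adj H x z > 0"
    using \<open>y \<noteq> x\<close> by (auto simp: edge_rel_def elim: converse_rtranclE)
  have "adj H x z \<le> vertex_degree H x"
    unfolding vertex_degree_def using H z by (intro member_le_sum) (auto simp: locally_finite_def)
  then show "1 \<le> (case p of (H, x) \<Rightarrow> vertex_degree H x)" using z by (simp add: px)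
qed

section \<open>Degree averages under local convergence\<close>

locale locally_convergent_graphs = random_graph_sequence +
  fixes \<Lambda> :: "rgraph measure"
  assumes prob_space_limit: "prob_space \<Lambda>"
    and sets_limit: "sets \<Lambda> = sets borel"
    and uniformly_integrable_degrees: "uniformly_integrable (SIGMA n:{2..}. {1..n}) (\<lambda>(n, i). M n)
      (\<lambda>(n, i) \<omega>. (real (vertex_degree (G n \<omega>) i))\<^sup>2)"
    and local_limit: "locally_conv_in_prob M G \<Lambda>"
begin

sublocale limit: prob_space \<Lambda>
  by (rule prob_space_limit)

lemma measurable_root_degree: "(\<lambda>x. (\<phi> :: nat \<Rightarrow> real) (root_degree x)) \<in> borel_measurable \<Lambda>"
  using borel_measurable_continuous_onI[OF continuous_on_root_degree[of \<phi>]]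
    measurable_cong_sets[OF sets_limit refl] by blast

lemma integrable_bounded_degree: "(\<And>d. \<bar>\<phi> d\<bar> \<le> (B :: real)) \<Longrightarrow> integrable \<Lambda> (\<lambda>x. \<phi> (root_degree x))"
  by (intro limit.integrable_const_bound[where B = B] measurable_root_degree) auto

text \<open>
  As a bounded continuous function of the rooted component, \<open>\<phi>\<close> of the root degree is an
  admissible test function for local convergence.
\<close>
lemma degree_avg_conv_bounded:
  assumes "\<And>d. \<bar>\<phi> d\<bar> \<le> B"
  shows "conv (\<lambda>n. degree_avg n \<phi>) (\<integral>x. \<phi> (root_degree x) \<partial>\<Lambda>)"
proof -
  let ?h = "\<lambda>x. \<phi> (root_degree x)" and ?c = "\<integral>x. \<phi> (root_degree x) \<partial>\<Lambda>"
  have "bounded (range ?h)" using assms by (auto simp: bounded_iff)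
  then have "conv_in_prob M (\<lambda>n \<omega>. (\<Sum>i\<in>{1..n}. ?h (component_at (G n \<omega>) i)) / real n) ?c"
    using local_limit continuous_on_root_degree by (auto simp: locally_conv_in_prob_def)
  moreover have "(\<Sum>i\<in>{1..n}. ?h (component_at (G n \<omega>) i)) / real n = degree_avg n \<phi> (G n \<omega>)"
    if "n \<ge> 2" "\<omega> \<in> space (M n)" for n \<omega>
    using multigraph_G[OF that] by (auto simp: degree_avg_def root_degree_component_at intro!: arg_cong2[where f="(/)"] sum.cong)
  then have "{\<omega>\<in>space (M n). \<bar>(\<Sum>i\<in>{1..n}. ?h (component_at (G n \<omega>) i)) / real n - ?c\<bar> > \<epsilon>} =
      {\<omega>\<in>space (M n). \<bar>degree_avg n \<phi> (G n \<omega>) - ?c\<bar> > \<epsilon>}" if "n \<ge> 2" for n \<epsilon>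
    using that by auto
  ultimately show ?thesis
    unfolding conv_def conv_in_prob_def
    by (auto elim!: Lim_transform_eventually intro!: eventually_sequentiallyI[of 2])
qed

text \<open>
  In some graph of the sequence the average of the truncated \<open>d\<^sup>2\<close> is within \<open>1\<close> of its limit while
  the averaged tail above a fixed level \<open>K\<close> is at most \<open>1\<close>.  There the average is at most \<open>K\<^sup>2 + 1\<close>,
  whatever the truncation \<open>k\<close>.
\<close>
lemma truncated_second_moment_bounded:
  "\<exists>B\<ge>0. \<forall>k. (\<integral>x. (if root_degree x \<le> k then (real (root_degree x))\<^sup>2 else 0) \<partial>\<Lambda>) \<le> B"
proof -
  obtain K where K: "\<And>n. n \<ge> 2 \<Longrightarrow>
      fail_prob (\<lambda>n H. degree_avg n (\<lambda>d. if d > K then (real d)\<^sup>2 else 0) H \<le> 1) n \<le> 1 / 2"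
    using uniform_tail[OF uniformly_integrable_degrees, of 1 "1 / 2"] by auto
  let ?\<phi> = "\<lambda>k d. if d \<le> k then (real d)\<^sup>2 else 0" and ?tail = "\<lambda>d. if d > K then (real d)\<^sup>2 else 0"
  have "(\<integral>x. ?\<phi> k (root_degree x) \<partial>\<Lambda>) \<le> (real K)\<^sup>2 + 2" for k
  proof -
    let ?c = "\<integral>x. ?\<phi> k (root_degree x) \<partial>\<Lambda>"
    have "conv (\<lambda>n. degree_avg n (?\<phi> k)) ?c"
      by (rule degree_avg_conv_bounded[of _ "(real k)\<^sup>2"]) (auto intro: power_mono)
    then have "whp (\<lambda>n H. \<bar>degree_avg n (?\<phi> k) H - ?c\<bar> \<le> 1)" by (rule conv_whp) simp
    from whp_realised[OF this K] obtain n \<omega> where n: "n \<ge> 2"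
      "\<bar>degree_avg n (?\<phi> k) (G n \<omega>) - ?c\<bar> \<le> 1" "degree_avg n ?tail (G n \<omega>) \<le> 1"
      by auto
    have "degree_avg n (?\<phi> k) (G n \<omega>) \<le> degree_avg n (\<lambda>d. (real K)\<^sup>2 + ?tail d) (G n \<omega>)"
      by (rule degree_avg_mono) (auto intro: power_mono)
    also have "\<dots> = (real K)\<^sup>2 + degree_avg n ?tail (G n \<omega>)"
      using n(1) by (intro degree_avg_const_add) simp
    finally show ?thesis using n(2,3) by linarith
  qed
  then show ?thesis by (intro exI[of _ "(real K)\<^sup>2 + 2"]) auto
qed

lemma integrable_square_root_degree: "integrable \<Lambda> (\<lambda>x. (real (root_degree x))\<^sup>2)"
proof -
  obtain B where B: "B \<ge> 0" "\<And>k. (\<integral>x. (if root_degree x \<le> k then (real (root_degree x))\<^sup>2 else 0) \<partial>\<Lambda>) \<le> B"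
    using truncated_second_moment_bounded by blast
  let ?\<phi> = "\<lambda>k d. if d \<le> k then (real d)\<^sup>2 else 0"
  have "(\<integral>\<^sup>+x. ennreal ((real (root_degree x))\<^sup>2) \<partial>\<Lambda>) = (\<integral>\<^sup>+x. (SUP k. ennreal (?\<phi> k (root_degree x))) \<partial>\<Lambda>)"
  proof (intro nn_integral_cong antisym)
    fix x
    show "ennreal ((real (root_degree x))\<^sup>2) \<le> (SUP k. ennreal (?\<phi> k (root_degree x)))"
      by (rule SUP_upper2[of "root_degree x"]) auto
    show "(SUP k. ennreal (?\<phi> k (root_degree x))) \<le> ennreal ((real (root_degree x))\<^sup>2)"
      by (intro SUP_least) auto
  qed
  also have "\<dots> = (SUP k. \<integral>\<^sup>+x. ennreal (?\<phi> k (root_degree x)) \<partial>\<Lambda>)"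
  proof (rule nn_integral_monotone_convergence_SUP)
    show "incseq (\<lambda>k x. ennreal (?\<phi> k (root_degree x)))"
      unfolding incseq_def le_fun_def by (intro allI impI ennreal_leI) simp
    show "(\<lambda>x. ennreal (?\<phi> k (root_degree x))) \<in> borel_measurable \<Lambda>" for k
      by (rule measurable_compose[OF measurable_root_degree measurable_ennreal])
  qed
  also have "\<dots> \<le> ennreal B"
  proof (rule SUP_least)
    fix k
    have "(\<integral>\<^sup>+x. ennreal (?\<phi> k (root_degree x)) \<partial>\<Lambda>) = ennreal (\<integral>x. ?\<phi> k (root_degree x) \<partial>\<Lambda>)"
      by (intro nn_integral_eq_integral integrable_bounded_degree[of "?\<phi> k" "(real k)\<^sup>2"])
        (auto intro: power_mono)
    then show "(\<integral>\<^sup>+x. ennreal (?\<phi> k (root_degree x)) \<partial>\<Lambda>) \<le> ennreal B"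
      using B(2)[of k] by (simp add: ennreal_leI)
  qed
  finally have fin: "(\<integral>\<^sup>+x. ennreal ((real (root_degree x))\<^sup>2) \<partial>\<Lambda>) < \<infinity>"
    by (rule le_less_trans) simp
  show ?thesis
    by (rule integrableI_nonneg[OF measurable_root_degree[of "\<lambda>d. (real d)\<^sup>2"] _ fin]) simp
qed

text \<open>
  The law of large numbers for degrees.  Cutting \<open>\<phi>\<close> off above a level \<open>k\<close> makes it bounded; the
  error is at most the averaged tail of \<open>d\<^sup>2\<close> in the graph, small by uniform integrability, and in the
  limit it is small by dominated convergence.
\<close>
theorem degree_avg_conv:
  assumes \<phi>: "\<And>d. \<bar>\<phi> d\<bar> \<le> (real d)\<^sup>2"
  shows "conv (\<lambda>n. degree_avg n \<phi>) (\<integral>x. \<phi> (root_degree x) \<partial>\<Lambda>)"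
  unfolding conv_iff_whp
proof (intro allI impI whp_approx)
  fix \<epsilon> \<eta> :: real assume pos: "\<epsilon> > 0" "\<eta> > 0"
  let ?\<phi> = "\<lambda>k d. if d \<le> k then \<phi> d else 0" and ?tail = "\<lambda>K d. if d > K then (real d)\<^sup>2 else 0"
  let ?c = "\<integral>x. \<phi> (root_degree x) \<partial>\<Lambda>" and ?ck = "\<lambda>k. \<integral>x. ?\<phi> k (root_degree x) \<partial>\<Lambda>"
  obtain K where K: "\<forall>n\<ge>2. fail_prob (\<lambda>n H. degree_avg n (?tail K) H \<le> \<epsilon> / 3) n \<le> \<eta>"
    using uniform_tail[OF uniformly_integrable_degrees, of "\<epsilon> / 3" \<eta>] pos by auto
  have "?ck \<longlonglongrightarrow> ?c"
  proof (rule integral_dominated_convergence[OF _ _ integrable_square_root_degree])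
    show "AE x in \<Lambda>. (\<lambda>k. ?\<phi> k (root_degree x)) \<longlonglongrightarrow> \<phi> (root_degree x)"
    proof (rule AE_I2)
      fix x
      show "(\<lambda>k. ?\<phi> k (root_degree x)) \<longlonglongrightarrow> \<phi> (root_degree x)"
        by (rule tendsto_eventually, rule eventually_sequentiallyI[of "root_degree x"]) simp
    qed
    show "(\<lambda>x. \<phi> (root_degree x)) \<in> borel_measurable \<Lambda>"
      and "(\<lambda>x. ?\<phi> k (root_degree x)) \<in> borel_measurable \<Lambda>" for k
      by (rule measurable_root_degree)+
    show "AE x in \<Lambda>. norm (?\<phi> k (root_degree x)) \<le> (real (root_degree x))\<^sup>2" for k
      using \<phi> by auto
  qed
  then have "eventually (\<lambda>k. dist (?ck k) ?c < \<epsilon> / 3) sequentially"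
    using pos by (intro tendstoD) auto
  then obtain k0 where k0: "\<And>k. k \<ge> k0 \<Longrightarrow> dist (?ck k) ?c < \<epsilon> / 3"
    by (auto simp: eventually_sequentially)
  define k where "k = max k0 K"
  have ck: "\<bar>?ck k - ?c\<bar> < \<epsilon> / 3" using k0[of k] by (simp add: k_def dist_real_def)
  have "conv (\<lambda>n. degree_avg n (?\<phi> k)) (?ck k)"
  proof (rule degree_avg_conv_bounded)
    show "\<bar>?\<phi> k d\<bar> \<le> (real k)\<^sup>2" for d
      using \<phi>[of d] by (auto intro: order_trans power_mono)
  qed
  then have "whp (\<lambda>n H. \<bar>degree_avg n (?\<phi> k) H - ?ck k\<bar> \<le> \<epsilon> / 3)" by (rule conv_whp) (use pos in simp)
  moreover have "\<bar>degree_avg n \<phi> H - ?c\<bar> \<le> \<epsilon>"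
    if "\<bar>degree_avg n (?\<phi> k) H - ?ck k\<bar> \<le> \<epsilon> / 3" "degree_avg n (?tail K) H \<le> \<epsilon> / 3" for n H
  proof -
    have "\<bar>degree_avg n \<phi> H - degree_avg n (?\<phi> k) H\<bar> \<le> degree_avg n (?tail K) H"
      using \<phi> by (intro degree_avg_close) (auto simp: k_def)
    then show ?thesis using that ck by linarith
  qed
  ultimately show "\<exists>P Q. whp P \<and> (\<forall>n\<ge>2. fail_prob Q n \<le> \<eta>) \<and>
      (\<forall>n\<ge>2. \<forall>\<omega>\<in>space (M n). P n (G n \<omega>) \<longrightarrow> Q n (G n \<omega>) \<longrightarrow>
        \<bar>degree_avg n \<phi> (G n \<omega>) - ?c\<bar> \<le> \<epsilon>)"
    using K by blast
qed

end

section \<open>The stationary measure in the limit\<close>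

lemma Delta_st_connected:
  assumes H: "multigraph H" "verts H = {1..n}" "graph_connected H" and i: "i \<in> {1..n}"
  shows "Delta_st H i = degree_avg n (\<lambda>d. (real d)\<^sup>2) H / degree_avg n real H - real (vertex_degree H i)"
proof -
  have C: "verts (component H j) = {1..n}" if "j \<in> {1..n}" for j
  proof -
    have j: "j \<in> verts H" using that H(2) by simp
    have "{y. (j, y) \<in> (edge_rel H)\<^sup>*} = verts H"
      using reachable_in_verts[OF H(1) j] H(3) j unfolding graph_connected_def by blast
    then show ?thesis using verts_component[OF H(1) j] H(2) by simp
  qed
  have "(\<Sum>j\<in>{1..n}. pi_c H j * real (vertex_degree H j)) =
      (\<Sum>j\<in>{1..n}. (real (vertex_degree H j))\<^sup>2 / (\<Sum>j\<in>{1..n}. real (vertex_degree H j)))"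
    by (intro sum.cong refl) (simp only: pi_c_def C power2_eq_square times_divide_eq_left)
  then show ?thesis
    using i by (simp add: Delta_st_def C degree_avg_def sum_divide_distrib[symmetric])
qed

text \<open>
  The average degree bounds the fraction of vertices of degree above \<open>K\<close> by \<open>m / K\<close>, so that only
  arguments in a compact interval matter, where \<open>f\<close> is uniformly continuous.  The two cases are
  merged into the single bound \<open>\<epsilon> / 2 + (2 B / K) d\<close> for a vertex of degree \<open>d\<close>.
\<close>
lemma avg_shift_close:
  fixes f :: "real \<Rightarrow> real"
  assumes f: "continuous_on UNIV f" and B: "\<And>x. \<bar>f x\<bar> \<le> B" and "\<epsilon> > 0"
  shows "\<exists>\<eta>>0. \<forall>n\<ge>1. \<forall>y H. \<bar>y - c\<bar> \<le> \<eta> \<longrightarrow> degree_avg n real H \<le> m \<longrightarrow>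
    \<bar>degree_avg n (\<lambda>d. f (y - real d)) H - degree_avg n (\<lambda>d. f (c - real d)) H\<bar> \<le> \<epsilon>"
proof -
  have B0: "B \<ge> 0" using B[of 0] by simp
  obtain K :: nat where K: "real K > 4 * B * \<bar>m\<bar> / \<epsilon> + 1" using reals_Archimedean2 by blast
  have "0 \<le> 4 * B * \<bar>m\<bar> / \<epsilon>" using B0 assms(3) by simp
  then have K1: "real K > 1" "4 * B * \<bar>m\<bar> / \<epsilon> \<le> real K" using K by linarith+
  let ?I = "{c - real K - 1..c + 1}"
  have "uniformly_continuous_on ?I f"
    using f by (intro compact_uniformly_continuous continuous_on_subset[OF f]) auto
  then obtain r where r: "r > 0" "\<And>x y. x \<in> ?I \<Longrightarrow> y \<in> ?I \<Longrightarrow> dist y x < r \<Longrightarrow> dist (f y) (f x) < \<epsilon> / 2"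
    using assms(3) unfolding uniformly_continuous_on_def by (meson half_gt_zero)
  define \<eta> where "\<eta> = min 1 (r / 2)"
  have "\<bar>degree_avg n (\<lambda>d. f (y - real d)) H - degree_avg n (\<lambda>d. f (c - real d)) H\<bar> \<le> \<epsilon>"
    if n: "n \<ge> 1" and y: "\<bar>y - c\<bar> \<le> \<eta>" and m: "degree_avg n real H \<le> m" for n y H
  proof -
    have "\<bar>f (y - real d) - f (c - real d)\<bar> \<le> \<epsilon> / 2 + 2 * B / real K * real d" for d
    proof (cases "d \<le> K")
      case True
      have "dist (f (y - real d)) (f (c - real d)) < \<epsilon> / 2"
        using y True r(1) unfolding \<eta>_def by (intro r(2)) (auto simp: dist_real_def)
      moreover have "0 \<le> 2 * B / real K * real d" using B0 by simp
      ultimately show ?thesis by (simp add: dist_real_def)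
    next
      case False
      have "\<bar>f (y - real d) - f (c - real d)\<bar> \<le> 2 * B * 1"
        using B[of "y - real d"] B[of "c - real d"] by linarith
      also have "\<dots> \<le> 2 * B * (real d / real K)"
        using False B0 K1 by (intro mult_left_mono) (auto simp: field_simps)
      finally show ?thesis using assms(3) by simp
    qed
    then have "\<bar>degree_avg n (\<lambda>d. f (y - real d)) H - degree_avg n (\<lambda>d. f (c - real d)) H\<bar>
        \<le> degree_avg n (\<lambda>d. \<epsilon> / 2 + 2 * B / real K * real d) H"
      by (rule degree_avg_close)
    also have "\<dots> = \<epsilon> / 2 + 2 * B / real K * degree_avg n real H"
      using n by (simp only: degree_avg_const_add degree_avg_scale)
    also have "\<dots> \<le> \<epsilon> / 2 + 2 * B / real K * \<bar>m\<bar>"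
      using m B0 by (intro add_left_mono mult_left_mono) auto
    also have "2 * B / real K * \<bar>m\<bar> \<le> \<epsilon> / 2"
      using K1 assms(3) by (simp add: field_simps)
    finally show ?thesis by simp
  qed
  moreover have "\<eta> > 0" using r by (simp add: \<eta>_def)
  ultimately show ?thesis by blast
qed

context locally_convergent_graphs
begin

lemma integrable_root_degree: "integrable \<Lambda> (\<lambda>x. real (root_degree x))"
proof (rule Bochner_Integration.integrable_bound[OF integrable_square_root_degree])
  show "AE x in \<Lambda>. norm (real (root_degree x)) \<le> norm ((real (root_degree x))\<^sup>2)"
    by (auto simp: power2_eq_square mult_le_cancel_left1)
qed (rule measurable_root_degree)

lemma root_moment_1_pos:
  assumes "AE x in \<Lambda>. is_nontrivial_tree x"
  shows "root_moment 1 \<Lambda> > 0"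
proof -
  have "(\<integral>x. 1 \<partial>\<Lambda>) \<le> (\<integral>x. real (root_degree x) \<partial>\<Lambda>)"
    using assms by (intro integral_mono_AE integrable_root_degree)
      (auto elim!: eventually_mono dest: root_degree_pos)
  then show ?thesis by (simp add: root_moment_def limit.prob_space)
qed

lemma degree_moments_conv:
  "conv (\<lambda>n. degree_avg n real) (root_moment 1 \<Lambda>)"
  "conv (\<lambda>n. degree_avg n (\<lambda>d. (real d)\<^sup>2)) (root_moment 2 \<Lambda>)"
  using degree_avg_conv[of real] degree_avg_conv[of "\<lambda>d. (real d)\<^sup>2"]
  by (simp_all add: root_moment_def power2_eq_square mult_le_cancel_left1)

text \<open>
  With high probability the graph is connected, its common shift is close to \<open>c\<close> and its average
  degree is at most \<open>m\<^sup>(\<^sup>1\<^sup>) + 1\<close>.  Then the integral of \<open>f\<close> against \<open>mu_st\<close> is close to the average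
  of \<open>f (c - d\<^sub>i)\<close>, to which the law of large numbers for bounded functions applies.
\<close>
theorem mu_st_weak_conv:
  assumes tree: "AE x in \<Lambda>. is_nontrivial_tree x"
    and connected: "(\<lambda>n. measure (M n) {\<omega>\<in>space (M n). graph_connected (G n \<omega>)}) \<longlonglongrightarrow> 1"
  shows "weak_conv_in_prob M (\<lambda>n \<omega>. mu_st n (G n \<omega>)) (mu_limit \<Lambda>)"
  unfolding weak_conv_in_prob_def
proof (intro allI impI)
  fix f :: "real \<Rightarrow> real" assume "continuous_on UNIV f \<and> bounded (range f)"
  then have f: "continuous_on UNIV f" and "bounded (range f)" by auto
  then obtain B where B: "\<And>x. \<bar>f x\<bar> \<le> B" by (auto simp: bounded_iff)
  have [measurable]: "f \<in> borel_measurable borel" by (rule borel_measurable_continuous_onI[OF f])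
  let ?Y = "\<lambda>n H. degree_avg n (\<lambda>d. (real d)\<^sup>2) H / degree_avg n real H"
  let ?m = "root_moment 1 \<Lambda>"
  define c where "c = root_moment 2 \<Lambda> / ?m"
  let ?L = "\<integral>x. f (c - real (root_degree x)) \<partial>\<Lambda>"
  have L: "(\<integral>x. f x \<partial>mu_limit \<Lambda>) = ?L"
    unfolding mu_limit_def c_def by (intro integral_distr measurable_root_degree) simp
  have "1 - fail_prob (\<lambda>_. graph_connected) n = measure (M n) {\<omega>\<in>space (M n). graph_connected (G n \<omega>)}"
    if "n \<ge> 2" for n
  proof -
    interpret prob_space "M n" using that prob_space_M by blast
    show ?thesis
      unfolding fail_prob_def using prob_compl[OF sets_G[OF that, of graph_connected]]
      by (simp add: set_diff_eq Collect_conj_eq[symmetric] conj_commute cong: conj_cong)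
  qed
  then have "(\<lambda>n. 1 - fail_prob (\<lambda>_. graph_connected) n) \<longlonglongrightarrow> 1"
    by (intro Lim_transform_eventually[OF connected]) (auto intro!: eventually_sequentiallyI[of 2])
  from tendsto_diff[OF tendsto_const[of 1] this]
  have conn: "whp (\<lambda>_. graph_connected)" by (simp add: whp_def)
  have Y: "conv ?Y c"
    unfolding c_def using root_moment_1_pos[OF tree]
    by (intro conv_continuous2[of _ _ _ _ "(/)"] degree_moments_conv continuous_intros) auto
  have "conv (\<lambda>n H. (\<Sum>i\<in>{1..n}. f (Delta_st H i)) / real n) ?L"
    unfolding conv_iff_whp
  proof (intro allI impI)
    fix \<epsilon> :: real assume "\<epsilon> > 0"
    then obtain \<eta> where \<eta>: "\<eta> > 0" "\<And>n y H. n \<ge> 1 \<Longrightarrow> \<bar>y - c\<bar> \<le> \<eta> \<Longrightarrow> degree_avg n real H \<le> ?m + 1 \<Longrightarrow>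
        \<bar>degree_avg n (\<lambda>d. f (y - real d)) H - degree_avg n (\<lambda>d. f (c - real d)) H\<bar> \<le> \<epsilon> / 2"
      using avg_shift_close[OF f B, of "\<epsilon> / 2" c "?m + 1"] by auto
    have S1: "whp (\<lambda>n H. \<bar>degree_avg n real H - ?m\<bar> \<le> 1)"
      by (rule conv_whp[OF degree_moments_conv(1)]) simp
    have near: "whp (\<lambda>n H. \<bar>degree_avg n (\<lambda>d. f (?Y n H - real d)) H
        - degree_avg n (\<lambda>d. f (c - real d)) H\<bar> \<le> \<epsilon> / 2)"
    proof (rule whp_combine[OF conv_whp[OF Y \<eta>(1)] S1])
      fix n \<omega> assume "n \<ge> 2" "\<bar>?Y n (G n \<omega>) - c\<bar> \<le> \<eta>" "\<bar>degree_avg n real (G n \<omega>) - ?m\<bar> \<le> 1"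
      then show "\<bar>degree_avg n (\<lambda>d. f (?Y n (G n \<omega>) - real d)) (G n \<omega>)
          - degree_avg n (\<lambda>d. f (c - real d)) (G n \<omega>)\<bar> \<le> \<epsilon> / 2"
        by (intro \<eta>(2)) linarith+
    qed
    have "whp (\<lambda>n H. \<bar>degree_avg n (\<lambda>d. f (c - real d)) H - ?L\<bar> \<le> \<epsilon> / 2)"
      using B \<open>\<epsilon> > 0\<close> by (intro conv_whp degree_avg_conv_bounded[of "\<lambda>d. f (c - real d)" B]) auto
    with near have "whp (\<lambda>n H. \<bar>degree_avg n (\<lambda>d. f (?Y n H - real d)) H - ?L\<bar> \<le> \<epsilon>)"
      by (rule whp_combine) linarith
    then show "whp (\<lambda>n H. \<bar>(\<Sum>i\<in>{1..n}. f (Delta_st H i)) / real n - ?L\<bar> \<le> \<epsilon>)"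
    proof (rule whp_combine[OF _ conn])
      fix n \<omega> assume n: "n \<ge> 2" "\<omega> \<in> space (M n)" and conn: "graph_connected (G n \<omega>)"
        and le: "\<bar>degree_avg n (\<lambda>d. f (?Y n (G n \<omega>) - real d)) (G n \<omega>) - ?L\<bar> \<le> \<epsilon>"
      have "(\<Sum>i\<in>{1..n}. f (Delta_st (G n \<omega>) i)) / real n =
          degree_avg n (\<lambda>d. f (?Y n (G n \<omega>) - real d)) (G n \<omega>)"
        unfolding degree_avg_def[of n "\<lambda>d. f (?Y n (G n \<omega>) - real d)"]
        using multigraph_G[OF n] conn by (simp add: Delta_st_connected)
      then show "\<bar>(\<Sum>i\<in>{1..n}. f (Delta_st (G n \<omega>) i)) / real n - ?L\<bar> \<le> \<epsilon>" using le by simp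
    qed
  qed
  then show "conv_in_prob M (\<lambda>n \<omega>. \<integral>x. f x \<partial>mu_st n (G n \<omega>)) (\<integral>x. f x \<partial>mu_limit \<Lambda>)"
    by (simp add: conv_def L mu_st_def integral_empirical_measure)
qed

end

theorem theorem4p4:
  fixes M :: "nat \<Rightarrow> 'a measure"
    and G :: "nat \<Rightarrow> 'a \<Rightarrow> mgraph"
    and \<delta> :: real
  assumes random_graph: "\<And>n. n \<ge> 2 \<Longrightarrow> random_multigraph (M n) {1..n} (G n)"
    and loopless: "\<And>n \<omega>. n \<ge> 2 \<Longrightarrow> \<omega> \<in> space (M n) \<Longrightarrow> loopless (G n \<omega>)"
    and no_isolated: "\<And>n \<omega>. n \<ge> 2 \<Longrightarrow> \<omega> \<in> space (M n) \<Longrightarrow> no_isolated_vertices (G n \<omega>)"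
    and laziness: "0 < \<delta>" "\<delta> < 1"
  shows
    "(\<forall>n\<ge>2. AE \<omega> in M n. weak_conv_m (\<lambda>k. mu_lazy \<delta> n k (G n \<omega>)) (mu_st n (G n \<omega>))) \<and>
     (\<forall>\<Lambda> :: rgraph measure.
        prob_space \<Lambda> \<and> sets \<Lambda> = sets borel \<and> (AE x in \<Lambda>. is_nontrivial_tree x) \<and>
        uniformly_integrable (SIGMA n:{2..}. {1..n}) (\<lambda>(n, i). M n)
          (\<lambda>(n, i) \<omega>. (real (vertex_degree (G n \<omega>) i))\<^sup>2) \<and>
        (\<lambda>n. measure (M n) {\<omega>\<in>space (M n). graph_connected (G n \<omega>)}) \<longlonglongrightarrow> 1 \<and>
        locally_conv_in_prob M G \<Lambda>
        \<longrightarrow> weak_conv_in_prob M (\<lambda>n \<omega>. mu_st n (G n \<omega>)) (mu_limit \<Lambda>))"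
proof (intro conjI allI impI AE_I2; (elim conjE)?)
  fix n \<omega> assume n: "2 \<le> n" and \<omega>: "\<omega> \<in> space (M n)"
  have "multigraph (G n \<omega>)" "verts (G n \<omega>) = {1..n}"
    using random_graph[OF n] \<omega> by (auto simp: random_multigraph_def)
  then show "weak_conv_m (\<lambda>k. mu_lazy \<delta> n k (G n \<omega>)) (mu_st n (G n \<omega>))"
    unfolding mu_lazy_def mu_st_def
    using n no_isolated[OF n \<omega>] laziness
    by (intro weak_conv_empirical_measure Delta_lazy_tendsto) auto
next
  fix \<Lambda> :: "rgraph measure"
  assume "prob_space \<Lambda>" "sets \<Lambda> = sets borel" and tree: "AE x in \<Lambda>. is_nontrivial_tree x"
    and "uniformly_integrable (SIGMA n:{2..}. {1..n}) (\<lambda>(n, i). M n)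
      (\<lambda>(n, i) \<omega>. (real (vertex_degree (G n \<omega>) i))\<^sup>2)"
    and connected: "(\<lambda>n. measure (M n) {\<omega>\<in>space (M n). graph_connected (G n \<omega>)}) \<longlonglongrightarrow> 1"
    and "locally_conv_in_prob M G \<Lambda>"
  then interpret locally_convergent_graphs M G \<Lambda>
    by (intro locally_convergent_graphs.intro random_graph_sequence.intro random_graph
        locally_convergent_graphs_axioms.intro)
  show "weak_conv_in_prob M (\<lambda>n \<omega>. mu_st n (G n \<omega>)) (mu_limit \<Lambda>)"
    by (rule mu_st_weak_conv[OF tree connected])
qed

end
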